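(* Let $x,y\in W^J$. Let $\mathbf{p}$ be a shortest directed path from $x$ to $y$ in $\mathrm{QB}(W^J)$ and let $\mathbf{q}$ be an arbitrary directed path from $x$ to $y$ in $\mathrm{QB}(W^J)$. Then there exists $h\in Q_+^\vee$ such that $$\mathrm{wt}(\mathbf{q})-\mathrm{wt}(\mathbf{p})\equiv h\mod Q_J^\vee.$$ In particular, if $\mathbf{q}$ is also shortest, then $\mathrm{wt}(\mathbf{q})\equiv\mathrm{wt}(\mathbf{p})\mod Q_J^\vee$.
   Context: $\Phi$ is the (irreducible) root system of a finite-dimensional simple Lie algebra, with Dynkin node set $I$, simple coroots $\alpha_i^\vee$, positive roots $\Phi^+$, Weyl group $W$ with length $\ell$, reflections $r_\alpha$, $\rho=\frac12\sum_{\alpha\in\Phi^+}\alpha$. $J\subseteq I$, $W_J=\langle r_i:i\in J\rangle$, $\Phi_J^+\subseteq\Phi^+$ the positive roots of its root system, $\rho_J=\frac12\sum_{\alpha\in\Phi_J^+}\alpha$, $Q_J^\vee=\bigoplus_{i\in J}\mathbb{Z}\alpha_i^\vee$, $Q_+^\vee=\sum_{i\in I}\mathbb{Z}_{\ge0}\alpha_i^\vee$, $W^J$ the set of minimum-length coset representatives of $W/W_J$, and $\lfloor w\rfloor\in W^J$ the minimum-length representative of $wW_J$. The parabolic quantum Bruhat graph $\mathrm{QB}(W^J)$ is the directed graph with vertex set $W^J$ and, for $w\in W^J$ and $\alpha\in\Phi^+\setminus\Phi_J^+$, an edge $w\overset{\alpha}{\longrightarrow}\lfloor wr_\alpha\rfloor$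 labeled $\alpha$ if either (Bruhat edge) $\ell(wr_\alpha)=\ell(w)+1$ (then $wr_\alpha\in W^J$), or (quantum edge) $\ell(\lfloor wr_\alpha\rfloor)=\ell(w)+1-\langle\alpha^\vee,2\rho-2\rho_J\rangle$. The weight of an edge labeled $\alpha$ is $\alpha^\vee$ if it is a quantum edge and $0$ if it is a Bruhat edge; the weight $\mathrm{wt}(\mathbf{p})$ of a directed path $\mathbf{p}$ is the sum of the weights of its edges. *)

theory Defs
  imports "HOL-Analysis.Analysis" "Graph_Theory.Arc_Walk"
begin

text \<open>
  Roots and coroots live in one Euclidean space whose inner product is Weyl-group invariant
  (for a simple Lie algebra: the real span of the roots with the form induced by the Killing form).
  Coroots are identified with vectors through the inner product, so the pairing of a coroot
  \<open>a\<close> with a weight \<open>b\<close> is \<open>a \<bullet> b\<close>.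
\<close>

definition coroot :: "'a::euclidean_space \<Rightarrow> 'a" where
  "coroot a = (2 / (a \<bullet> a)) *\<^sub>R a"

definition root_reflection :: "'a::euclidean_space \<Rightarrow> 'a \<Rightarrow> 'a" where
  "root_reflection a v = v - (coroot a \<bullet> v) *\<^sub>R a"

text \<open>Reduced crystallographic root systems, as they arise from semisimple Lie algebras.\<close>

definition root_system :: "'a::euclidean_space set \<Rightarrow> bool" where
  "root_system \<Phi> \<longleftrightarrow>
     finite \<Phi> \<and> 0 \<notin> \<Phi> \<and> span \<Phi> = UNIV \<and>
     (\<forall>a\<in>\<Phi>. \<forall>b\<in>\<Phi>. root_reflection a b \<in> \<Phi>) \<and>
     (\<forall>a\<in>\<Phi>. \<forall>b\<in>\<Phi>. coroot a \<bullet> b \<in> \<int>) \<and>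
     (\<forall>a\<in>\<Phi>. \<forall>c. c *\<^sub>R a \<in> \<Phi> \<longrightarrow> c = 1 \<or> c = - 1)"

definition irreducible_root_system :: "'a::euclidean_space set \<Rightarrow> bool" where
  "irreducible_root_system \<Phi> \<longleftrightarrow>
     root_system \<Phi> \<and> \<Phi> \<noteq> {} \<and>
     \<not> (\<exists>A B. \<Phi> = A \<union> B \<and> A \<noteq> {} \<and> B \<noteq> {} \<and> (\<forall>a\<in>A. \<forall>b\<in>B. a \<bullet> b = 0))"

text \<open>
  Throughout, \<open>\<alpha> i\<close> for \<open>i \<in> I\<close> are the simple roots, indexed by the Dynkin nodes.
\<close>

definition positive_roots :: "'a::euclidean_space set \<Rightarrow> 'i set \<Rightarrow> ('i \<Rightarrow> 'a) \<Rightarrow> 'a set" where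
  "positive_roots \<Phi> I \<alpha> = {b \<in> \<Phi>. \<exists>c::'i \<Rightarrow> nat. b = (\<Sum>i\<in>I. real (c i) *\<^sub>R \<alpha> i)}"

definition simple_roots :: "'a::euclidean_space set \<Rightarrow> 'i set \<Rightarrow> ('i \<Rightarrow> 'a) \<Rightarrow> bool" where
  "simple_roots \<Phi> I \<alpha> \<longleftrightarrow>
     finite I \<and> inj_on \<alpha> I \<and> independent (\<alpha> ` I) \<and> \<alpha> ` I \<subseteq> \<Phi> \<and>
     (\<forall>b\<in>\<Phi>. b \<in> positive_roots \<Phi> I \<alpha> \<or> - b \<in> positive_roots \<Phi> I \<alpha>)"

text \<open>
  The group generated by the simple reflections of \<open>J\<close>, as maps of the ambient space under
  composition. Inverses are not needed among the generators since these are involutions.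
\<close>

definition refl_word :: "('i \<Rightarrow> 'a::euclidean_space) \<Rightarrow> 'i list \<Rightarrow> 'a \<Rightarrow> 'a" where
  "refl_word \<alpha> is = foldr (\<lambda>i w. root_reflection (\<alpha> i) \<circ> w) is id"

definition weyl_group :: "('i \<Rightarrow> 'a::euclidean_space) \<Rightarrow> 'i set \<Rightarrow> ('a \<Rightarrow> 'a) set" where
  "weyl_group \<alpha> J = refl_word \<alpha> ` lists J"

definition weyl_length :: "'i set \<Rightarrow> ('i \<Rightarrow> 'a::euclidean_space) \<Rightarrow> ('a \<Rightarrow> 'a) \<Rightarrow> nat" where
  "weyl_length I \<alpha> w = (LEAST n. \<exists>is \<in> lists I. length is = n \<and> refl_word \<alpha> is = w)"

definition left_coset :: "('i \<Rightarrow> 'a::euclidean_space) \<Rightarrow> 'i set \<Rightarrow> ('a \<Rightarrow> 'a) \<Rightarrow> ('a \<Rightarrow> 'a) set" where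
  "left_coset \<alpha> J w = (\<lambda>u. w \<circ> u) ` weyl_group \<alpha> J"

definition min_coset_reps ::
    "'i set \<Rightarrow> ('i \<Rightarrow> 'a::euclidean_space) \<Rightarrow> 'i set \<Rightarrow> ('a \<Rightarrow> 'a) set" where
  "min_coset_reps I \<alpha> J =
     {w \<in> weyl_group \<alpha> I. \<forall>v \<in> left_coset \<alpha> J w. weyl_length I \<alpha> w \<le> weyl_length I \<alpha> v}"

definition coset_floor ::
    "'i set \<Rightarrow> ('i \<Rightarrow> 'a::euclidean_space) \<Rightarrow> 'i set \<Rightarrow> ('a \<Rightarrow> 'a) \<Rightarrow> ('a \<Rightarrow> 'a)" where
  "coset_floor I \<alpha> J w = (THE u. u \<in> left_coset \<alpha> J w \<and> u \<in> min_coset_reps I \<alpha> J)"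

text \<open>The roots of \<open>W\<^sub>J\<close> are the \<open>W\<^sub>J\<close>-conjugates of the simple roots of \<open>J\<close>.\<close>

definition parabolic_positive_roots ::
    "'a::euclidean_space set \<Rightarrow> 'i set \<Rightarrow> ('i \<Rightarrow> 'a) \<Rightarrow> 'i set \<Rightarrow> 'a set" where
  "parabolic_positive_roots \<Phi> I \<alpha> J =
     positive_roots \<Phi> I \<alpha> \<inter> {w (\<alpha> j) | w j. w \<in> weyl_group \<alpha> J \<and> j \<in> J}"

definition rho :: "'a::euclidean_space set \<Rightarrow> 'i set \<Rightarrow> ('i \<Rightarrow> 'a) \<Rightarrow> 'a" where
  "rho \<Phi> I \<alpha> = (1 / 2) *\<^sub>R (\<Sum>a\<in>positive_roots \<Phi> I \<alpha>. a)"

definition parabolic_rho ::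
    "'a::euclidean_space set \<Rightarrow> 'i set \<Rightarrow> ('i \<Rightarrow> 'a) \<Rightarrow> 'i set \<Rightarrow> 'a" where
  "parabolic_rho \<Phi> I \<alpha> J = (1 / 2) *\<^sub>R (\<Sum>a\<in>parabolic_positive_roots \<Phi> I \<alpha> J. a)"

definition coroot_lattice :: "('i \<Rightarrow> 'a::euclidean_space) \<Rightarrow> 'i set \<Rightarrow> 'a set" where
  "coroot_lattice \<alpha> J = {\<Sum>i\<in>J. of_int (c i) *\<^sub>R coroot (\<alpha> i) | c :: 'i \<Rightarrow> int. True}"

definition positive_coroot_cone :: "('i \<Rightarrow> 'a::euclidean_space) \<Rightarrow> 'i set \<Rightarrow> 'a set" where
  "positive_coroot_cone \<alpha> I = {\<Sum>i\<in>I. real (c i) *\<^sub>R coroot (\<alpha> i) | c :: 'i \<Rightarrow> nat. True}"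

definition bruhat_edge ::
    "'i set \<Rightarrow> ('i \<Rightarrow> 'a::euclidean_space) \<Rightarrow> ('a \<Rightarrow> 'a) \<Rightarrow> 'a \<Rightarrow> bool" where
  "bruhat_edge I \<alpha> w b \<longleftrightarrow>
     weyl_length I \<alpha> (w \<circ> root_reflection b) = weyl_length I \<alpha> w + 1"

definition quantum_edge ::
    "'a::euclidean_space set \<Rightarrow> 'i set \<Rightarrow> ('i \<Rightarrow> 'a) \<Rightarrow> 'i set \<Rightarrow> ('a \<Rightarrow> 'a) \<Rightarrow> 'a \<Rightarrow> bool" where
  "quantum_edge \<Phi> I \<alpha> J w b \<longleftrightarrow>
     real (weyl_length I \<alpha> (coset_floor I \<alpha> J (w \<circ> root_reflection b))) =
     real (weyl_length I \<alpha> w) + 1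
       - coroot b \<bullet> (2 *\<^sub>R rho \<Phi> I \<alpha> - 2 *\<^sub>R parabolic_rho \<Phi> I \<alpha> J)"

text \<open>
  An arc is a pair of its source and its label, which together determine the target.
  Directed paths are the walks of this digraph: vertices and arcs may repeat.
\<close>

definition parabolic_QB ::
    "'a::euclidean_space set \<Rightarrow> 'i set \<Rightarrow> ('i \<Rightarrow> 'a) \<Rightarrow> 'i set
      \<Rightarrow> ('a \<Rightarrow> 'a, ('a \<Rightarrow> 'a) \<times> 'a) pre_digraph" where
  "parabolic_QB \<Phi> I \<alpha> J =
     \<lparr> verts = min_coset_reps I \<alpha> J,
       arcs = {(w, b). w \<in> min_coset_reps I \<alpha> J \<and>
                 b \<in> positive_roots \<Phi> I \<alpha> - parabolic_positive_roots \<Phi> I \<alpha> J \<and>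
                 (bruhat_edge I \<alpha> w b \<or> quantum_edge \<Phi> I \<alpha> J w b)},
       tail = (\<lambda>(w, b). w),
       head = (\<lambda>(w, b). coset_floor I \<alpha> J (w \<circ> root_reflection b)) \<rparr>"

text \<open>
  No arc is both a Bruhat and a quantum edge, because a coroot outside the parabolic pairs
  strictly positively with the weight in the quantum condition; hence the weight is unambiguous.
\<close>

definition edge_weight ::
    "'a::euclidean_space set \<Rightarrow> 'i set \<Rightarrow> ('i \<Rightarrow> 'a) \<Rightarrow> 'i set \<Rightarrow> ('a \<Rightarrow> 'a) \<times> 'a \<Rightarrow> 'a" where
  "edge_weight \<Phi> I \<alpha> J = (\<lambda>(w, b). if quantum_edge \<Phi> I \<alpha> J w b then coroot b else 0)"

definition path_weight ::
    "'a::euclidean_space set \<Rightarrow> 'i set \<Rightarrow> ('i \<Rightarrow> 'a) \<Rightarrow> 'i set \<Rightarrow> (('a \<Rightarrow> 'a) \<times> 'a) list \<Rightarrow> 'a" where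
  "path_weight \<Phi> I \<alpha> J p = sum_list (map (edge_weight \<Phi> I \<alpha> J) p)"

definition shortest_walk :: "('v, 'e) pre_digraph \<Rightarrow> 'v \<Rightarrow> 'e list \<Rightarrow> 'v \<Rightarrow> bool" where
  "shortest_walk G x p y \<longleftrightarrow>
     pre_digraph.awalk G x p y \<and> (\<forall>p'. pre_digraph.awalk G x p' y \<longrightarrow> length p \<le> length p')"

end

theory Submission
  imports Defs
begin

text \<open>
  Write \<open>d \<le> d'\<close> if \<open>d' - d\<close> is a nonnegative combination of simple coroots modulo the coroot
  lattice of \<open>J\<close>. The claim is that the weights of all paths from \<open>x\<close> to \<open>y\<close> have a least
  element and that the shortest paths attain it. The proof transports the set of
  pairs (number of edges, weight) along left multiplication by the affine simple reflections, that
  is, by the simple reflections and the reflection at the highest root \<open>\<theta>\<close>, which plays the role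
  of the affine node with gradient \<open>- \<theta>\<close>.

  A gradient \<open>a\<close> is an ascent, a descent or neutral at a coset according to the sign of
  \<open>lev (inv x a)\<close>, where \<open>lev\<close> is the coefficient sum over the simple roots outside \<open>J\<close>; neutral
  means that multiplication fixes the coset. If \<open>a\<close> is an ascent, then multiplication by its
  reflection is an edge (\<open>qb_edge_up\<close>), a quantum edge exactly for the affine node. The diamond
  property says how another edge interacts with \<open>a\<close>: along an edge an ascent stays an ascent and a
  neutral gradient does not become a descent, unless the edge is the multiplication itself
  (\<open>qb_edge_sign_change\<close>); and an edge between two ascents or two descents can be reflected
  (\<open>qb_edge_reflect\<close>). Under reflection the weights change by a coboundary.

  Three moves follow. If \<open>a\<close> is an ascent at \<open>x\<close> but not at \<open>y\<close>, every path from \<open>x\<close> to \<open>y\<close>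
  contains an edge that is the multiplication; cutting it out and reflecting what comes before
  leaves a path from the reflected \<open>x\<close> to \<open>y\<close> that is one edge shorter, with a weight change depending only on \<open>x\<close> (\<open>strip_start\<close>). Dually
  for a descent at \<open>y\<close> that is not one at \<open>x\<close> (\<open>strip_end\<close>). If \<open>a\<close> is an ascent at both
  ends, both ends can be reflected and the number of edges is kept (\<open>reflect_ascents\<close>). All
  three are reversible, so existence of a least weight passes between the pairs involved.

  It remains to see that by such moves the two ends can be brought together. From \<open>x\<close>, ascents lead
  to the trivial coset (\<open>ascent_induct\<close>): the linear relation between the simple roots and
  \<open>\<theta>\<close> defines a positive circulation on the graph of ascents, and a finite graph with a
  positive circulation is strongly connected as soon as it is connected. On the way the path may get
  shorter. If it does not, \<open>x\<close> arrives at the trivial coset, and there any simple root that is a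
  descent at \<open>y\<close> shortens the path. When the ends meet, the empty path has weight 0, and all weights are \<open>\<ge> 0\<close> because
  coroots of positive roots are nonnegative combinations of simple ones.

  Throughout, cosets are replaced by arbitrary representatives and lengths of minimal
  representatives by the number of inverted roots outside the parabolic subsystem, which is
  constant on cosets. The length of \<open>x \<circ> root_reflection g\<close> is compared with that of \<open>x\<close> root by
  root (\<open>inversions_right\<close>), and this turns the Bruhat and quantum conditions into sign conditions
  on single roots (\<open>inversions_right_up_iff\<close>, \<open>inversions_right_down\<close>) from which the diamond
  property is read off by comparing heights.
\<close>


section \<open>Reflections\<close>

lemma root_reflection_eq: "root_reflection a v = v - (2 * (a \<bullet> v) / (a \<bullet> a)) *\<^sub>R a"
  by (simp add: root_reflection_def coroot_def)

lemma linear_root_reflection: "linear (root_reflection a)"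
  unfolding root_reflection_def
  by (rule linearI) (simp_all add: inner_add_right scaleR_add_left algebra_simps)

lemma inner_root_reflection: "root_reflection a u \<bullet> root_reflection a v = u \<bullet> v"
  by (cases "a = 0")
    (simp_all add: root_reflection_eq inner_diff_left inner_diff_right inner_commute field_simps)

lemma root_reflection_self: "root_reflection a a = - a"
  by (cases "a = 0") (simp_all add: root_reflection_eq scaleR_2)

lemma coroot_inner_self: "a \<noteq> 0 \<Longrightarrow> coroot a \<bullet> a = 2"
  by (simp add: coroot_def)

lemma root_reflection_involution [simp]: "root_reflection a (root_reflection a v) = v"
  by (cases "a = 0")
    (simp_all add: root_reflection_eq inner_diff_right field_simps flip: scaleR_add_left)

lemma root_reflection_comp_self [simp]: "root_reflection a \<circ> root_reflection a = id"
  by (simp add: fun_eq_iff)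

lemma root_reflection_comp_self_left [simp]:
  "root_reflection a \<circ> (root_reflection a \<circ> w) = w"
  by (simp add: fun_eq_iff)

lemma bij_root_reflection: "bij (root_reflection a)"
  by (rule involuntory_imp_bij) simp

lemma inv_root_reflection [simp]: "inv (root_reflection a) = root_reflection a"
  by (rule inv_equality) simp_all

lemma root_reflection_minus [simp]: "root_reflection (- a) = root_reflection a"
  by (simp add: root_reflection_eq fun_eq_iff)

lemma coroot_minus [simp]: "coroot (- a) = - coroot a"
  by (simp add: coroot_def)

text \<open>
  The reflection can equally be read on the coroot side; this is what makes coroots
  transform like roots.
\<close>

lemma root_reflection_coroot_form: "root_reflection a v = v - (a \<bullet> v) *\<^sub>R coroot a"
  by (simp add: root_reflection_eq coroot_def)

definition orthogonal_map :: "('a::euclidean_space \<Rightarrow> 'a) \<Rightarrow> bool" where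
  "orthogonal_map w \<longleftrightarrow> linear w \<and> bij w \<and> (\<forall>u v. w u \<bullet> w v = u \<bullet> v)"

lemma orthogonal_map_root_reflection: "orthogonal_map (root_reflection a)"
  by (simp add: orthogonal_map_def linear_root_reflection bij_root_reflection inner_root_reflection)

lemma orthogonal_map_comp:
  "orthogonal_map u \<Longrightarrow> orthogonal_map w \<Longrightarrow> orthogonal_map (u \<circ> w)"
  by (auto simp: orthogonal_map_def bij_comp intro: linear_compose)

lemma coroot_orthogonal: "orthogonal_map w \<Longrightarrow> coroot (w a) = w (coroot a)"
  by (simp add: orthogonal_map_def coroot_def linear_scale)

lemma root_reflection_conj:
  assumes "orthogonal_map w"
  shows "root_reflection (w a) \<circ> w = w \<circ> root_reflection a"
  using assms coroot_orthogonal[OF assms, of a]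
  by (auto simp: fun_eq_iff root_reflection_def orthogonal_map_def linear_diff linear_scale)

section \<open>Levels of roots and the Weyl group\<close>

locale root_basis =
  fixes \<Phi> :: "'a::euclidean_space set" and I :: "'i set" and \<alpha> :: "'i \<Rightarrow> 'a"
  assumes root_system: "root_system \<Phi>"
    and simple_roots: "simple_roots \<Phi> I \<alpha>"
begin

abbreviation "s i \<equiv> root_reflection (\<alpha> i)"
abbreviation "W \<equiv> weyl_group \<alpha>"

lemma finite_roots: "finite \<Phi>" and zero_notin_roots: "0 \<notin> \<Phi>" and span_roots: "span \<Phi> = UNIV"
  using root_system by (auto simp: root_system_def)

lemma reflect_root: "a \<in> \<Phi> \<Longrightarrow> b \<in> \<Phi> \<Longrightarrow> root_reflection a b \<in> \<Phi>"
  using root_system by (auto simp: root_system_def)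

lemma pairing_Ints: "a \<in> \<Phi> \<Longrightarrow> b \<in> \<Phi> \<Longrightarrow> coroot a \<bullet> b \<in> \<int>"
  using root_system by (auto simp: root_system_def)

lemma multiple_root: "a \<in> \<Phi> \<Longrightarrow> c *\<^sub>R a \<in> \<Phi> \<Longrightarrow> c = 1 \<or> c = - 1"
  using root_system by (auto simp: root_system_def)

lemma root_nonzero: "a \<in> \<Phi> \<Longrightarrow> a \<noteq> 0"
  using zero_notin_roots by auto

lemma uminus_root [simp]: "- a \<in> \<Phi> \<longleftrightarrow> a \<in> \<Phi>"
  using reflect_root[of a a] reflect_root[of "-a" "-a"]
    root_reflection_self[of a] root_reflection_self[of "-a"] by fastforce

lemma finite_I: "finite I" and inj_simple: "inj_on \<alpha> I" and independent_simple: "independent (\<alpha> ` I)"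
  using simple_roots by (auto simp: simple_roots_def)

lemma simple_root: "i \<in> I \<Longrightarrow> \<alpha> i \<in> \<Phi>"
  using simple_roots by (auto simp: simple_roots_def)

lemma simple_nonzero: "i \<in> I \<Longrightarrow> \<alpha> i \<noteq> 0"
  using simple_root root_nonzero by blast

text \<open>
  The coefficient sum of a vector over the simple roots in \<open>K\<close>. For \<open>K = I\<close> it is the height;
  for \<open>K = I - J\<close> it separates the roots of the parabolic subsystem of \<open>J\<close>, where it vanishes,
  from the other positive and negative ones.
\<close>

definition level :: "'i set \<Rightarrow> 'a \<Rightarrow> real" where
  "level K = (SOME g. linear g \<and> (\<forall>i\<in>I. g (\<alpha> i) = (if i \<in> K then 1 else 0)))"

abbreviation "height \<equiv> level I"

lemma level_props: "linear (level K) \<and> (\<forall>i\<in>I. level K (\<alpha> i) = (if i \<in> K then 1 else 0))"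
proof -
  obtain g where g: "linear g"
    "\<forall>v\<in>\<alpha> ` I. g v = (if the_inv_into I \<alpha> v \<in> K then 1 else 0 :: real)"
    using linear_independent_extend[OF independent_simple,
        of "\<lambda>v. if the_inv_into I \<alpha> v \<in> K then 1 else 0 :: real"] by blast
  then have "\<forall>i\<in>I. g (\<alpha> i) = (if i \<in> K then 1 else 0)"
    by (simp add: the_inv_into_f_f[OF inj_simple])
  with g(1) have "\<exists>g. linear g \<and> (\<forall>i\<in>I. g (\<alpha> i) = (if i \<in> K then 1 else 0 :: real))"
    by blast
  then show ?thesis unfolding level_def by (rule someI_ex)
qed

lemma linear_level: "linear (level K)"
  using level_props by blast

lemma level_simple: "i \<in> I \<Longrightarrow> level K (\<alpha> i) = (if i \<in> K then 1 else 0)"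
  using level_props by blast

lemma level_minus [simp]: "level K (- v) = - level K v"
  and level_diff: "level K (u - v) = level K u - level K v"
  and level_scale: "level K (c *\<^sub>R v) = c * level K v"
  by (simp_all only: linear_neg[OF linear_level] linear_diff[OF linear_level]
    linear_scale[OF linear_level] real_scaleR_def)

lemma level_reflect: "level K (root_reflection a v) = level K v - (coroot a \<bullet> v) * level K a"
  by (simp add: root_reflection_def level_diff level_scale)

lemma level_combination:
  "level K (\<Sum>i\<in>I. c i *\<^sub>R \<alpha> i) = (\<Sum>i\<in>I \<inter> K. c i)"
proof -
  have "level K (\<Sum>i\<in>I. c i *\<^sub>R \<alpha> i) = (\<Sum>i\<in>I. c i * level K (\<alpha> i))"
    by (simp add: linear_sum[OF linear_level] level_scale)
  also have "\<dots> = (\<Sum>i\<in>I. if i \<in> K then c i else 0)"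
    by (rule sum.cong) (simp_all add: level_simple)
  finally show ?thesis
    by (simp add: sum.inter_restrict finite_I)
qed

lemma positive_or_negative: "b \<in> \<Phi> \<Longrightarrow> b \<in> positive_roots \<Phi> I \<alpha> \<or> - b \<in> positive_roots \<Phi> I \<alpha>"
  using simple_roots by (auto simp: simple_roots_def)

lemma positive_level:
  assumes "b \<in> positive_roots \<Phi> I \<alpha>"
  shows "0 \<le> level K b" and "level K b \<le> height b" and "height b \<ge> 1"
    and "level K b \<in> \<nat>"
proof -
  obtain c where b: "b \<in> \<Phi>" "b = (\<Sum>i\<in>I. real (c i) *\<^sub>R \<alpha> i)"
    using assms by (auto simp: positive_roots_def)
  have l: "level K b = real (\<Sum>i\<in>I \<inter> K. c i)" for K
    using b level_combination[of K "\<lambda>i. real (c i)"] by simp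
  then show "0 \<le> level K b" "level K b \<in> \<nat>"
    by (simp_all del: of_nat_sum)
  have "(\<Sum>i\<in>I \<inter> K. c i) \<le> (\<Sum>i\<in>I \<inter> I. c i)"
    by (rule sum_mono2) (auto simp: finite_I)
  then show "level K b \<le> height b"
    by (simp only: l of_nat_le_iff)
  have "(\<Sum>i\<in>I. c i) \<noteq> 0"
  proof
    assume "(\<Sum>i\<in>I. c i) = 0"
    then have "\<forall>i\<in>I. c i = 0" by (simp add: finite_I)
    then have "b = 0" using b by simp
    then show False using b root_nonzero by blast
  qed
  then show "height b \<ge> 1" by (simp add: l del: of_nat_sum)
qed

lemma positive_roots_eq: "positive_roots \<Phi> I \<alpha> = {b \<in> \<Phi>. height b > 0}"
proof -
  have "b \<in> positive_roots \<Phi> I \<alpha>" if "b \<in> \<Phi>" "height b > 0" for b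
    using positive_or_negative[OF that(1)] positive_level(3)[of "-b"] that by auto
  moreover have "b \<in> \<Phi>" "height b > 0" if "b \<in> positive_roots \<Phi> I \<alpha>" for b
    using that positive_level(3)[OF that] by (auto simp: positive_roots_def)
  ultimately show ?thesis by auto
qed

lemma height_cases: "b \<in> \<Phi> \<Longrightarrow> height b \<ge> 1 \<or> height b \<le> -1"
  using positive_or_negative[of b] positive_level(3)[of b] positive_level(3)[of "- b"] by auto

lemma height_nonzero: "b \<in> \<Phi> \<Longrightarrow> height b \<noteq> 0"
  using height_cases[of b] by auto

lemma height_pos_ge1: "b \<in> \<Phi> \<Longrightarrow> height b > 0 \<Longrightarrow> height b \<ge> 1"
  using height_cases[of b] by auto

lemma level_nonneg: "b \<in> \<Phi> \<Longrightarrow> height b > 0 \<Longrightarrow> level K b \<ge> 0"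
  using positive_level(1)[of b] by (auto simp: positive_roots_eq)

lemma level_pos_imp_height_pos: "b \<in> \<Phi> \<Longrightarrow> level K b > 0 \<Longrightarrow> height b > 0"
  using level_nonneg[of "-b" K] height_cases[of b] by fastforce

lemma level_neg_imp_height_neg: "b \<in> \<Phi> \<Longrightarrow> level K b < 0 \<Longrightarrow> height b < 0"
  using level_pos_imp_height_pos[of "-b" K] by simp

lemma positive_coefficients:
  assumes "b \<in> \<Phi>" "height b > 0"
  obtains c where "b = (\<Sum>i\<in>I. real (c i) *\<^sub>R \<alpha> i)"
proof -
  have "b \<in> positive_roots \<Phi> I \<alpha>" using assms by (simp add: positive_roots_eq)
  then show ?thesis using that by (auto simp: positive_roots_def)
qed

text \<open>
  A reflection at a simple root changes only one coefficient, so a positive root not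
  proportional to it keeps a positive coefficient and stays positive.
\<close>

lemma simple_reflection_positive:
  assumes b: "b \<in> \<Phi>" "height b > 0" and i: "i \<in> I" and ne: "b \<noteq> \<alpha> i"
  shows "height (s i b) > 0"
proof (rule ccontr)
  obtain c where c: "b = (\<Sum>k\<in>I. real (c k) *\<^sub>R \<alpha> k)"
    using positive_coefficients[OF b] .
  assume neg: "\<not> height (s i b) > 0"
  have s: "s i b \<in> \<Phi>" using reflect_root simple_root b i by blast
  then have n: "level K (s i b) \<le> 0" for K
    using neg level_pos_imp_height_pos[of "s i b" K] by force
  have "c k = 0" if "k \<in> I" "k \<noteq> i" for k
  proof -
    have "level {k} (s i b) = level {k} b"
      using that i by (simp add: level_reflect level_simple)
    also have "\<dots> = c k" using that by (simp add: c level_combination)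
    finally show ?thesis using n[of "{k}"] by simp
  qed
  then have "b = (\<Sum>k\<in>I. if k = i then real (c i) *\<^sub>R \<alpha> i else 0)"
    unfolding c by (intro sum.cong) auto
  then have b': "b = real (c i) *\<^sub>R \<alpha> i"
    using i by (simp add: finite_I)
  then have "real (c i) = 1"
    using multiple_root[OF simple_root[OF i], of "real (c i)"] b by auto
  with b' ne show False by simp
qed

lemma refl_word_Nil [simp]: "refl_word \<alpha> [] = id"
  and refl_word_Cons [simp]: "refl_word \<alpha> (i # is) = s i \<circ> refl_word \<alpha> is"
  by (simp_all add: refl_word_def)

lemma refl_word_append: "refl_word \<alpha> (is @ js) = refl_word \<alpha> is \<circ> refl_word \<alpha> js"
  by (induction "is") (simp_all add: comp_assoc)

lemma W_id [simp]: "id \<in> W K"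
  unfolding weyl_group_def by (rule image_eqI[of _ _ "[]"]) simp_all

lemma W_comp: "u \<in> W K \<Longrightarrow> w \<in> W K \<Longrightarrow> u \<circ> w \<in> W K"
  unfolding weyl_group_def
proof (elim imageE)
  fix js ks assume "u = refl_word \<alpha> js" "w = refl_word \<alpha> ks" "js \<in> lists K" "ks \<in> lists K"
  then show "u \<circ> w \<in> refl_word \<alpha> ` lists K"
    by (intro image_eqI[of _ _ "js @ ks"]) (auto simp: refl_word_append)
qed

lemma W_simple: "i \<in> K \<Longrightarrow> s i \<in> W K"
  unfolding weyl_group_def by (rule image_eqI[of _ _ "[i]"]) simp_all

lemma W_induct [consumes 1, case_names id simple]:
  assumes "w \<in> W K" and "P id" and "\<And>i w. i \<in> K \<Longrightarrow> w \<in> W K \<Longrightarrow> P w \<Longrightarrow> P (s i \<circ> w)"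
  shows "P w"
proof -
  obtain js where js: "js \<in> lists K" "w = refl_word \<alpha> js"
    using assms(1) by (auto simp: weyl_group_def)
  have "P (refl_word \<alpha> js)" using js(1)
  proof (induction js)
    case (Cons i js)
    then have "refl_word \<alpha> js \<in> W K" by (auto simp: weyl_group_def)
    then show ?case using Cons assms(3) by (metis Cons_in_lists_iff refl_word_Cons)
  qed (metis assms(2) refl_word_Nil)
  then show ?thesis using js by simp
qed

lemma W_mono: "K \<subseteq> L \<Longrightarrow> W K \<subseteq> W L"
  unfolding weyl_group_def by (intro image_mono lists_mono)

lemma W_orthogonal: "w \<in> W K \<Longrightarrow> orthogonal_map w"
proof (induction rule: W_induct)
  case id
  show ?case by (metis orthogonal_map_comp orthogonal_map_root_reflection root_reflection_comp_self)
qed (rule orthogonal_map_comp[OF orthogonal_map_root_reflection])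

lemma W_bij: "w \<in> W K \<Longrightarrow> bij w"
  using W_orthogonal by (auto simp: orthogonal_map_def)

lemma W_linear: "w \<in> W K \<Longrightarrow> linear w"
  using W_orthogonal by (auto simp: orthogonal_map_def)

lemma W_inner: "w \<in> W K \<Longrightarrow> w u \<bullet> w v = u \<bullet> v"
  using W_orthogonal by (auto simp: orthogonal_map_def)

lemma W_minus: "w \<in> W K \<Longrightarrow> w (- v) = - w v"
  using W_linear linear_neg by blast

lemma W_inv: "w \<in> W K \<Longrightarrow> inv w \<in> W K"
proof (induction rule: W_induct)
  case (simple i w)
  then have "inv (s i \<circ> w) = inv w \<circ> s i"
    using o_inv_distrib[OF bij_root_reflection W_bij] by simp
  then show ?case using simple W_comp W_simple by metis
qed (metis W_id inv_id)

lemma W_inv_left [simp]: "w \<in> W K \<Longrightarrow> inv w (w v) = v"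
  and W_inv_right [simp]: "w \<in> W K \<Longrightarrow> w (inv w v) = v"
  using W_bij[of w K] by (simp_all add: bij_is_inj bij_is_surj surj_f_inv_f)

lemma W_comp_inv [simp]: "w \<in> W K \<Longrightarrow> w \<circ> inv w = id"
  and W_inv_comp [simp]: "w \<in> W K \<Longrightarrow> inv w \<circ> w = id"
  by (simp_all add: fun_eq_iff)

lemma W_comp_inv_left: "w \<in> W K \<Longrightarrow> w \<circ> (inv w \<circ> v) = v"
  by (simp add: fun_eq_iff)

lemma inv_comp_W: "u \<in> W K \<Longrightarrow> w \<in> W L \<Longrightarrow> inv (u \<circ> w) = inv w \<circ> inv u"
  using o_inv_distrib W_bij by blast

lemma W_root: "w \<in> W I \<Longrightarrow> b \<in> \<Phi> \<Longrightarrow> w b \<in> \<Phi>"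
  by (induction rule: W_induct) (auto intro: reflect_root simple_root)

lemma coroot_W: "w \<in> W K \<Longrightarrow> coroot (w b) = w (coroot b)"
  using coroot_orthogonal W_orthogonal by blast

lemma reflection_W: "w \<in> W K \<Longrightarrow> root_reflection (w b) \<circ> w = w \<circ> root_reflection b"
  using root_reflection_conj W_orthogonal by blast

lemma reflection_W_eq: "w \<in> W K \<Longrightarrow> root_reflection (w b) = w \<circ> root_reflection b \<circ> inv w"
  using reflection_W[of w K b] W_comp_inv[of w K] by (metis comp_assoc comp_id)

lemma reflection_inv_W: "w \<in> W K \<Longrightarrow> w \<circ> root_reflection (inv w b) = root_reflection b \<circ> w"
  using reflection_W[of w K "inv w b"] by simp

lemma finite_W: "finite (W I)"
proof -
  have "inj_on (\<lambda>w. restrict w \<Phi>) (W I)"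
  proof (rule inj_onI)
    fix u w assume uw: "u \<in> W I" "w \<in> W I" "restrict u \<Phi> = restrict w \<Phi>"
    then have "u b = w b" if "b \<in> \<Phi>" for b
      using that by (metis restrict_apply')
    moreover have "v \<in> span \<Phi>" for v by (simp add: span_roots)
    ultimately have "u v = w v" for v
      using linear_eq_on[OF W_linear[OF uw(1)] W_linear[OF uw(2)]] by blast
    then show "u = w" by blast
  qed
  moreover have "(\<lambda>w. restrict w \<Phi>) ` W I \<subseteq> \<Phi> \<rightarrow>\<^sub>E \<Phi>"
    using W_root by auto
  ultimately show ?thesis
    using finite_PiE[OF finite_roots, of "\<lambda>_. \<Phi>"] finite_roots finite_subset
    by (metis finite_imageD)
qed

text \<open>
  A positive root \<open>b\<close> pairs positively with some simple root in its support, because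
  \<open>b \<bullet> b > 0\<close>. Reflecting there lowers the height, which gives an induction on
  positive roots that never leaves the span of the simple roots in \<open>K\<close>.
\<close>

lemma exists_descending_simple:
  assumes b: "b \<in> \<Phi>" "height b > 0"
  obtains i where "i \<in> I" "coroot (\<alpha> i) \<bullet> b > 0" "level {i} b > 0"
proof -
  obtain c where c: "b = (\<Sum>k\<in>I. real (c k) *\<^sub>R \<alpha> k)"
    using positive_coefficients[OF b] .
  have "0 < b \<bullet> b" using b root_nonzero by simp
  also have "b \<bullet> b = (\<Sum>k\<in>I. real (c k) * (\<alpha> k \<bullet> b))"
    by (subst c) (simp add: inner_sum_left)
  finally obtain i where i: "i \<in> I" "real (c i) * (\<alpha> i \<bullet> b) > 0"
    by (meson not_less sum_nonpos)
  then have "c i > 0" "\<alpha> i \<bullet> b > 0"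
    by (auto simp: zero_less_mult_iff)
  moreover have "level {i} b = c i" using i by (simp add: c level_combination)
  moreover have "\<alpha> i \<bullet> \<alpha> i > 0" using i simple_nonzero by simp
  ultimately show ?thesis using i that by (simp add: coroot_def)
qed

lemma positive_root_induct [consumes 3, case_names simple reflect]:
  assumes b: "b \<in> \<Phi>" "height b > 0" "level (I - K) b = 0"
    and simple: "\<And>i. i \<in> I \<inter> K \<Longrightarrow> P (\<alpha> i)"
    and step: "\<And>b i. b \<in> \<Phi> \<Longrightarrow> height b > 0 \<Longrightarrow> i \<in> I \<inter> K \<Longrightarrow> coroot (\<alpha> i) \<bullet> b > 0 \<Longrightarrow>
      height (s i b) > 0 \<Longrightarrow> P (s i b) \<Longrightarrow> P b"
  shows "P b"
  using b
proof (induction "nat \<lfloor>height b\<rfloor>" arbitrary: b rule: less_induct)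
  case less
  obtain i where i: "i \<in> I" "coroot (\<alpha> i) \<bullet> b > 0" "level {i} b > 0"
    using exists_descending_simple less.prems by metis
  have K: "i \<in> K"
  proof (rule ccontr)
    assume n: "i \<notin> K"
    obtain c where c: "b = (\<Sum>k\<in>I. real (c k) *\<^sub>R \<alpha> k)"
      using positive_coefficients less.prems by blast
    have "(\<Sum>k\<in>I-K. c k) = 0"
      using less.prems(3) level_combination[of "I - K" "\<lambda>k. real (c k)"]
      by (simp add: c Int_absorb1 Diff_subset flip: of_nat_sum)
    then have "c i = 0" using i n finite_I by simp
    then show False using i by (simp add: c level_combination)
  qed
  show ?case
  proof (cases "b = \<alpha> i")
    case True
    then show ?thesis using simple i K by blast
  next
    case False
    then have pos: "height (s i b) > 0"
      using simple_reflection_positive less.prems i by blast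
    have r: "s i b \<in> \<Phi>" using reflect_root simple_root less.prems i by blast
    have "coroot (\<alpha> i) \<bullet> b \<ge> 1"
      using i(2) pairing_Ints[OF simple_root[OF i(1)] less.prems(1)] by (auto elim!: Ints_cases)
    then have "height (s i b) \<le> height b - 1"
      using i by (simp add: level_reflect level_simple)
    then have lt: "nat \<lfloor>height (s i b)\<rfloor> < nat \<lfloor>height b\<rfloor>"
      using height_pos_ge1[OF r pos] by linarith
    have "level (I - K) (s i b) = 0"
      using less.prems(3) i K by (simp add: level_reflect level_simple)
    then show ?thesis
      using step[OF less.prems(1,2) _ i(2) pos less.hyps[OF lt r pos]] i K by blast
  qed
qed

lemma positive_root_conjugate_simple:
  assumes "b \<in> \<Phi>" "height b > 0" "level (I - K) b = 0"
  shows "\<exists>w\<in>W K. \<exists>i\<in>I \<inter> K. b = w (\<alpha> i)"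
  using assms
proof (induction rule: positive_root_induct)
  case (simple i)
  then show ?case by (intro bexI[of _ id] bexI[of _ i]) auto
next
  case (reflect b i)
  then obtain w k where w: "w \<in> W K" "k \<in> I \<inter> K" "s i b = w (\<alpha> k)" by blast
  have "b = (s i \<circ> w) (\<alpha> k)" using w(3) by (metis comp_apply root_reflection_involution)
  moreover have "s i \<circ> w \<in> W K" using W_comp W_simple reflect w by blast
  ultimately show ?case using w by blast
qed

lemma root_conjugate_simple:
  assumes "b \<in> \<Phi>"
  shows "\<exists>w\<in>W I. \<exists>i\<in>I. b = w (\<alpha> i)"
proof -
  have pos: "\<exists>w\<in>W I. \<exists>i\<in>I. b = w (\<alpha> i)" if b: "b \<in> \<Phi>" "height b > 0" for b
  proof -
    obtain c where c: "b = (\<Sum>k\<in>I. real (c k) *\<^sub>R \<alpha> k)"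
      by (rule positive_coefficients[OF b])
    have "level (I - I) b = 0" by (simp add: c level_combination)
    then show ?thesis using positive_root_conjugate_simple[OF b, of I] by auto
  qed
  show ?thesis
  proof (cases "height b > 0")
    case False
    then have "height (- b) > 0" using height_cases[OF assms] by auto
    then obtain w i where w: "w \<in> W I" "i \<in> I" "- b = w (\<alpha> i)" using pos[of "-b"] assms by auto
    have "w (s i (\<alpha> i)) = b"
      using w W_minus[OF w(1)] by (simp add: root_reflection_self flip: w(3))
    then have "b = (w \<circ> s i) (\<alpha> i)" by simp
    then show ?thesis using w W_comp W_simple by metis
  qed (use pos assms in blast)
qed

lemma reflection_in_W: "b \<in> \<Phi> \<Longrightarrow> root_reflection b \<in> W I"
  using root_conjugate_simple[of b] reflection_W_eq W_comp W_inv W_simple by metis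

lemma reflection_in_parabolic:
  assumes "b \<in> \<Phi>" "level (I - K) b = 0"
  shows "root_reflection b \<in> W K"
proof -
  have pos: "root_reflection b \<in> W K" if "b \<in> \<Phi>" "level (I - K) b = 0" "height b > 0" for b
    using positive_root_conjugate_simple[OF that(1,3,2)] reflection_W_eq W_comp W_inv W_simple
    by (metis IntD2)
  show ?thesis
    using pos[of b] pos[of "- b"] height_cases[OF assms(1)] assms by fastforce
qed

text \<open>The parabolic Weyl group does not see the levels outside its own simple roots.\<close>

lemma level_parabolic:
  assumes "u \<in> W K" "K \<subseteq> I"
  shows "level (I - K) (u v) = level (I - K) v"
  using assms
proof (induction rule: W_induct)
  case (simple i w)
  then show ?case by (auto simp: level_reflect level_simple)
qed simp

lemma parabolic_positive_roots_eq:
  assumes "K \<subseteq> I"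
  shows "parabolic_positive_roots \<Phi> I \<alpha> K = {b \<in> \<Phi>. height b > 0 \<and> level (I - K) b = 0}"
proof -
  have "level (I - K) (w (\<alpha> j)) = 0" if "w \<in> W K" "j \<in> K" for w j
    using that assms by (auto simp: level_parabolic level_simple)
  moreover have "\<exists>w j. b = w (\<alpha> j) \<and> w \<in> W K \<and> j \<in> K"
    if "b \<in> \<Phi>" "height b > 0" "level (I - K) b = 0" for b
    using positive_root_conjugate_simple[OF that] by blast
  ultimately show ?thesis
    unfolding parabolic_positive_roots_def positive_roots_eq by auto
qed

text \<open>
  Coroots of positive roots are nonnegative integer combinations of simple coroots:
  along the induction on positive roots, undoing a reflection that lowered the height adds a
  positive multiple of a simple coroot.
\<close>

lemma coroot_in_cone:
  assumes "b \<in> \<Phi>" "height b > 0"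
  shows "coroot b \<in> positive_coroot_cone \<alpha> I"
proof -
  obtain c where "b = (\<Sum>k\<in>I. real (c k) *\<^sub>R \<alpha> k)"
    using positive_coefficients[OF assms] .
  then have "level (I - I) b = 0" by (simp add: level_combination)
  with assms show ?thesis
  proof (induction rule: positive_root_induct)
    case (simple i)
    have "(\<Sum>k\<in>I. real (if k = i then 1 else 0) *\<^sub>R coroot (\<alpha> k)) = (\<Sum>k\<in>I. if k = i then coroot (\<alpha> k) else 0)"
      by (intro sum.cong) auto
    also have "\<dots> = coroot (\<alpha> i)" using simple by (simp add: finite_I)
    finally show ?case unfolding positive_coroot_cone_def
      by (intro CollectI exI[of _ "\<lambda>k. if k = i then 1 else 0"]) simp
  next
    case (reflect b i)
    then obtain c where c: "coroot (s i b) = (\<Sum>k\<in>I. real (c k) *\<^sub>R coroot (\<alpha> k))"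
      by (auto simp: positive_coroot_cone_def)
    have ii: "i \<in> I" "\<alpha> i \<in> \<Phi>" using reflect simple_root by auto
    have "coroot b \<bullet> \<alpha> i \<in> \<int>" using pairing_Ints ii reflect by blast
    moreover have "coroot b \<bullet> \<alpha> i > 0"
    proof -
      have pos: "2 / (b \<bullet> b) > 0" "2 / (\<alpha> i \<bullet> \<alpha> i) > 0"
        using root_nonzero[OF reflect(1)] simple_nonzero[OF ii(1)] by simp_all
      have "2 / (\<alpha> i \<bullet> \<alpha> i) * (\<alpha> i \<bullet> b) > 0"
        using reflect(4) by (simp add: coroot_def)
      then have "b \<bullet> \<alpha> i > 0"
        using zero_less_mult_pos pos(2) by (metis inner_commute)
      then show ?thesis
        using mult_pos_pos[OF pos(1)] by (simp add: coroot_def)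
    qed
    ultimately obtain k where k: "coroot b \<bullet> \<alpha> i = real k"
      by (metis Ints_cases nonneg_int_cases of_int_0_less_iff of_int_of_nat_eq order_less_imp_le)
    have "coroot (s i b) = s i (coroot b)"
      using coroot_orthogonal orthogonal_map_root_reflection by blast
    then have "coroot b = coroot (s i b) + real k *\<^sub>R coroot (\<alpha> i)"
      by (simp add: root_reflection_coroot_form k[symmetric] inner_commute)
    also have "\<dots> = (\<Sum>j\<in>I. real (c j) *\<^sub>R coroot (\<alpha> j)) + (\<Sum>j\<in>I. if j = i then real k *\<^sub>R coroot (\<alpha> j) else 0)"
      using ii by (simp add: c finite_I)
    also have "\<dots> = (\<Sum>j\<in>I. real (c j + (if j = i then k else 0)) *\<^sub>R coroot (\<alpha> j))"
      unfolding sum.distrib[symmetric] by (intro sum.cong) (auto simp: scaleR_add_left)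
    finally show ?case unfolding positive_coroot_cone_def
      by (intro CollectI exI[of _ "\<lambda>j. c j + (if j = i then k else 0)"]) simp
  qed
qed

end

context root_basis
begin

section \<open>Counting inversions\<close>

definition roots_above :: "'i set \<Rightarrow> 'a set" where
  "roots_above K = {b \<in> \<Phi>. level K b > 0}"

text \<open>
  With \<open>K = I\<close> this is the usual number of inversions, hence the length. With \<open>K = I - J\<close>
  only roots outside the parabolic subsystem count, which makes it constant on the cosets of the
  parabolic subgroup and equal to the length of the minimal representative. Writing the
  indicator of negativity through signs turns length differences into sums of signs.
\<close>

definition inversions :: "'i set \<Rightarrow> ('a \<Rightarrow> 'a) \<Rightarrow> real" where
  "inversions K w = (\<Sum>b\<in>roots_above K. (1 - sgn (height (w b))) / 2)"

definition sum_above :: "'i set \<Rightarrow> 'a" where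
  "sum_above K = \<Sum>(roots_above K)"

lemma finite_roots_above [simp]: "finite (roots_above K)"
  using finite_roots by (simp add: roots_above_def)

lemma roots_above_root: "b \<in> roots_above K \<Longrightarrow> b \<in> \<Phi>"
  by (simp add: roots_above_def)

lemma roots_above_height: "b \<in> roots_above K \<Longrightarrow> height b > 0"
  using level_pos_imp_height_pos by (auto simp: roots_above_def)

lemma sgn_level: "b \<in> \<Phi> \<Longrightarrow>
    sgn (level K b) = of_bool (b \<in> roots_above K) - of_bool (- b \<in> roots_above K)"
  by (auto simp: roots_above_def sgn_if)

text \<open>
  How left multiplication by a reflection changes the number of inversions is decided root by
  root; for the reflections considered later the change on a root \<open>b\<close> is a boundary term at
  \<open>\<plusminus>a\<close> plus a term linear in \<open>b\<close>, and both can be summed.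
\<close>

lemma inversions_left:
  assumes w: "w \<in> W I" and a: "a \<in> \<Phi>"
    and flip: "\<And>b. b \<in> \<Phi> \<Longrightarrow> (sgn (height b) - sgn (height (root_reflection a b))) / 2
      = of_bool (b = a) - of_bool (b = - a) - \<epsilon> * (coroot a \<bullet> b)"
  shows "inversions K (root_reflection a \<circ> w) =
    inversions K w + sgn (level K (inv w a)) - \<epsilon> * (coroot (inv w a) \<bullet> sum_above K)"
proof -
  have hit: "(\<Sum>b\<in>roots_above K. of_bool (w b = c)) = (of_bool (inv w c \<in> roots_above K) :: real)"
    if "c \<in> \<Phi>" for c
  proof -
    have "(w b = c) = (b = inv w c)" for b using W_inv_left[OF w] W_inv_right[OF w] by metis
    then have "(\<Sum>b\<in>roots_above K. of_bool (w b = c))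
        = (\<Sum>b\<in>roots_above K. if b = inv w c then 1 else 0 :: real)"
      by (intro sum.cong) auto
    then show ?thesis by simp
  qed
  have pair: "coroot a \<bullet> w b = coroot (inv w a) \<bullet> b" for b
    using W_inner[OF W_inv[OF w], of "coroot a" "w b"] w by (simp add: coroot_W[OF W_inv[OF w]])
  have "inversions K (root_reflection a \<circ> w) - inversions K w
      = (\<Sum>b\<in>roots_above K. (sgn (height (w b)) - sgn (height (root_reflection a (w b)))) / 2)"
    by (simp add: inversions_def diff_divide_distrib flip: sum_subtractf)
  also have "\<dots> = (\<Sum>b\<in>roots_above K. of_bool (w b = a) - of_bool (w b = - a)
      - \<epsilon> * (coroot (inv w a) \<bullet> b))"
    using flip W_root[OF w] roots_above_root by (intro sum.cong) (simp_all add: pair)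
  also have "\<dots> = of_bool (inv w a \<in> roots_above K) - of_bool (- inv w a \<in> roots_above K)
      - \<epsilon> * (coroot (inv w a) \<bullet> sum_above K)"
    using hit[OF a] hit[of "- a"] a W_minus[OF W_inv[OF w], of a]
    by (simp add: sum_subtractf sum_above_def inner_sum_right sum_distrib_left)
  finally show ?thesis
    using sgn_level[of "inv w a" K] W_root[OF W_inv[OF w] a] by simp
qed

text \<open>The vanishing last term is the case \<open>\<epsilon> = 0\<close> of the hypothesis of \<open>inversions_left\<close>.\<close>

lemma simple_flip:
  assumes "i \<in> I" "b \<in> \<Phi>"
  shows "(sgn (height b) - sgn (height (s i b))) / 2
    = of_bool (b = \<alpha> i) - of_bool (b = - \<alpha> i) - 0 * (coroot (\<alpha> i) \<bullet> b)"
proof -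
  have ne: "\<alpha> i \<noteq> - \<alpha> i" using simple_nonzero[OF assms(1)] by (simp add: eq_neg_iff_add_eq_0 flip: scaleR_2)
  have sm: "s i (- b) = - s i b" for b
    using linear_neg[OF linear_root_reflection] by blast
  consider "b = \<alpha> i" | "b = - \<alpha> i" | "b \<noteq> \<alpha> i" "b \<noteq> - \<alpha> i" by blast
  then show ?thesis
  proof cases
    case 3
    show ?thesis
    proof (cases "height b > 0")
      case True
      then show ?thesis
        using simple_reflection_positive[of b i] assms 3 by simp
    next
      case False
      then have n: "height (- b) > 0" using height_cases[OF assms(2)] by auto
      moreover have "- b \<noteq> \<alpha> i" using 3(2) by (metis minus_minus)
      ultimately have "height (s i (- b)) > 0"
        using simple_reflection_positive[of "- b" i] assms by simp
      then show ?thesis using 3 n by (simp add: sm)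
    qed
  qed (use ne assms in \<open>simp_all add: root_reflection_self sm level_simple\<close>)
qed

lemma inversions_simple_left:
  assumes "w \<in> W I" "i \<in> I"
  shows "inversions K (s i \<circ> w) = inversions K w + sgn (level K (inv w (\<alpha> i)))"
  using inversions_left[OF assms(1) simple_root[OF assms(2)] simple_flip[OF assms(2)], of K] by simp

section \<open>Length and minimal coset representatives\<close>

lemma inversions_id: "inversions K id = 0"
  unfolding inversions_def using roots_above_height by (intro sum.neutral) auto

lemma refl_word_W: "js \<in> lists K \<Longrightarrow> refl_word \<alpha> js \<in> W K"
  by (auto simp: weyl_group_def)

text \<open>
  The exchange condition, with a reflection at an arbitrary positive root so that the induction on
  the word goes through.
\<close>

lemma exchange:
  assumes "js \<in> lists I" "b \<in> \<Phi>" "height b > 0" "height (inv (refl_word \<alpha> js) b) < 0"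
  shows "\<exists>ks\<in>lists I. length js = Suc (length ks) \<and>
    refl_word \<alpha> ks = root_reflection b \<circ> refl_word \<alpha> js"
  using assms
proof (induction js arbitrary: b rule: lists.induct)
  case Nil
  then show ?case by (simp add: inv_id)
next
  case (Cons i js)
  let ?w = "refl_word \<alpha> js"
  have i: "i \<in> I" and js: "js \<in> lists I" using Cons.hyps by auto
  have w: "?w \<in> W I" using js by (rule refl_word_W)
  have inv: "inv (refl_word \<alpha> (i # js)) b = inv ?w (s i b)"
    using inv_comp_W[OF W_simple[OF i] w] by simp
  show ?case
  proof (cases "b = \<alpha> i")
    case True
    then show ?thesis using js by (intro bexI[of _ js]) (simp_all flip: comp_assoc)
  next
    case False
    have "s i b \<in> \<Phi>" using reflect_root simple_root Cons.prems i by blast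
    moreover have "height (s i b) > 0"
      using simple_reflection_positive Cons.prems i False by blast
    moreover have "height (inv ?w (s i b)) < 0" using Cons.prems(3) by (metis inv)
    ultimately obtain ks where ks: "ks \<in> lists I" "length js = Suc (length ks)"
      "refl_word \<alpha> ks = root_reflection (s i b) \<circ> ?w"
      using Cons.IH by blast
    have "refl_word \<alpha> (i # ks) = root_reflection b \<circ> refl_word \<alpha> (i # js)"
      using reflection_W[OF W_simple[OF i], of "s i b"] ks(3)
      by (simp flip: comp_assoc)
    then show ?thesis using ks i by (intro bexI[of _ "i # ks"]) auto
  qed
qed

lemma exists_reduced_word:
  "w \<in> W I \<Longrightarrow> \<exists>js\<in>lists I. refl_word \<alpha> js = w \<and> real (length js) = inversions I w"
proof (induction rule: W_induct)
  case id
  show ?case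
    by (intro bexI[of _ "[]"] conjI)
      (simp_all only: inversions_id refl_word_Nil list.size of_nat_0 lists.Nil)
next
  case (simple i w)
  then obtain js where js: "js \<in> lists I" "refl_word \<alpha> js = w" "real (length js) = inversions I w"
    by blast
  have inv: "inversions I (s i \<circ> w) = inversions I w + sgn (height (inv w (\<alpha> i)))"
    using inversions_simple_left simple by blast
  have r: "inv w (\<alpha> i) \<in> \<Phi>" using W_root W_inv simple_root simple by blast
  show ?case
  proof (cases "height (inv w (\<alpha> i)) > 0")
    case True
    then have "inversions I (s i \<circ> w) = real (length (i # js))" using js(3) inv by simp
    moreover have "refl_word \<alpha> (i # js) = s i \<circ> w" using js(2) by simp
    moreover have "i # js \<in> lists I" using js(1) simple(1) by auto
    ultimately show ?thesis by metis
  next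
    case False
    then have neg: "height (inv w (\<alpha> i)) < 0" using height_cases[OF r] by auto
    have "height (\<alpha> i) > 0" using simple(1) by (simp add: level_simple)
    moreover have "height (inv (refl_word \<alpha> js) (\<alpha> i)) < 0" using neg js(2) by metis
    ultimately obtain ks where "ks \<in> lists I" "length js = Suc (length ks)"
      "refl_word \<alpha> ks = s i \<circ> w"
      using exchange[OF js(1) simple_root[OF simple(1)]] js(2) by metis
    moreover from this have "real (length ks) = inversions I (s i \<circ> w)"
      unfolding inv using js(3) neg by simp
    ultimately show ?thesis by blast
  qed
qed

lemma inversions_word_le: "js \<in> lists I \<Longrightarrow> inversions I (refl_word \<alpha> js) \<le> length js"
proof (induction js)
  case (Cons i js)
  then have "inversions I (s i \<circ> refl_word \<alpha> js) \<le> inversions I (refl_word \<alpha> js) + 1"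
    using inversions_simple_left[of "refl_word \<alpha> js" i I] refl_word_W by (auto simp: sgn_if)
  moreover have "inversions I (refl_word \<alpha> js) \<le> length js" using Cons by auto
  ultimately show ?case unfolding refl_word_Cons list.size by linarith
qed (simp only: inversions_id refl_word_Nil list.size of_nat_0 order.refl)

lemma weyl_length_eq_inversions:
  assumes "w \<in> W I"
  shows "real (weyl_length I \<alpha> w) = inversions I w"
proof -
  obtain js where js: "js \<in> lists I" "refl_word \<alpha> js = w" "real (length js) = inversions I w"
    using exists_reduced_word[OF assms] by blast
  have "weyl_length I \<alpha> w = length js"
    unfolding weyl_length_def
  proof (rule Least_equality)
    show "\<exists>is\<in>lists I. length is = length js \<and> refl_word \<alpha> is = w" using js by blast
    show "length js \<le> n" if "\<exists>is\<in>lists I. length is = n \<and> refl_word \<alpha> is = w" for n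
      using that inversions_word_le js(3) by force
  qed
  then show ?thesis using js by simp
qed

lemma positive_preserving_imp_id:
  assumes "w \<in> W I" "\<And>b. b \<in> \<Phi> \<Longrightarrow> height b > 0 \<Longrightarrow> height (w b) > 0"
  shows "w = id"
proof -
  have "inversions I w = 0"
    unfolding inversions_def using assms(2) roots_above_height roots_above_root
    by (intro sum.neutral) auto
  then show ?thesis using exists_reduced_word[OF assms(1)] by auto
qed

text \<open>
  Height is additive, so positivity on the simple roots of the parabolic is positivity on all of its
  positive roots.
\<close>

lemma positive_on_parabolic:
  assumes w: "w \<in> W I" and K: "K \<subseteq> I" and pos: "\<And>j. j \<in> K \<Longrightarrow> height (w (\<alpha> j)) > 0"
    and b: "b \<in> \<Phi>" "height b > 0" "level (I - K) b = 0"
  shows "height (w b) > 0"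
proof -
  obtain c where c: "b = (\<Sum>k\<in>I. real (c k) *\<^sub>R \<alpha> k)"
    by (rule positive_coefficients[OF b(1,2)])
  have "(\<Sum>k\<in>I-K. c k) = 0"
    using b(3) level_combination[of "I - K" "\<lambda>k. real (c k)"]
    by (simp add: c Int_absorb1 Diff_subset flip: of_nat_sum)
  then have z: "c k = 0" if "k \<in> I" "k \<notin> K" for k using that finite_I by simp
  have "height (w b) = (\<Sum>k\<in>I. real (c k) * height (w (\<alpha> k)))"
    by (simp add: c linear_sum[OF W_linear[OF w]] linear_scale[OF W_linear[OF w]]
        linear_sum[OF linear_level] level_scale)
  also have "\<dots> \<ge> 0"
  proof (rule sum_nonneg)
    fix k assume "k \<in> I"
    then show "0 \<le> real (c k) * height (w (\<alpha> k))"
      using z[of k] pos[of k] by (cases "k \<in> K") auto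
  qed
  finally show ?thesis
    using height_nonzero[OF W_root[OF w b(1)]] by simp
qed

section \<open>Right multiplication by a reflection\<close>

text \<open>
  The roots that \<open>root_reflection g\<close> moves out of \<open>roots_above K\<close>. It permutes the other
  members of \<open>roots_above K\<close>, so only these contribute to length differences.
\<close>

definition leaving :: "'i set \<Rightarrow> 'a \<Rightarrow> 'a set" where
  "leaving K g = {b \<in> roots_above K. level K (root_reflection g b) \<le> 0}"

lemma finite_leaving [simp]: "finite (leaving K g)"
  by (simp add: leaving_def)

lemma sum_roots_above_reflect:
  fixes F :: "'a \<Rightarrow> real"
  assumes g: "g \<in> \<Phi>"
  shows "(\<Sum>b\<in>roots_above K. F b - F (root_reflection g b))
    = (\<Sum>b\<in>leaving K g. F b - F (root_reflection g b))"
proof -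
  let ?r = "root_reflection g"
  define B where "B = roots_above K - leaving K g"
  have B: "B = {b \<in> \<Phi>. level K b > 0 \<and> level K (?r b) > 0}"
    by (auto simp: B_def leaving_def roots_above_def)
  have "(\<Sum>b\<in>B. F (?r b)) = (\<Sum>b\<in>B. F b)"
    by (rule sum.reindex_bij_witness[of _ ?r ?r]) (auto simp: B reflect_root[OF g])
  then have "(\<Sum>b\<in>B. F b - F (?r b)) = 0" by (simp add: sum_subtractf)
  moreover have "leaving K g \<subseteq> roots_above K" by (auto simp: leaving_def)
  ultimately show ?thesis
    using sum.subset_diff[of "leaving K g" "roots_above K" "\<lambda>b. F b - F (?r b)"]
    by (simp add: B_def)
qed

lemma inversions_right:
  assumes "g \<in> \<Phi>"
  shows "inversions K (w \<circ> root_reflection g) - inversions K w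
    = (\<Sum>b\<in>leaving K g. (sgn (height (w b)) - sgn (height (w (root_reflection g b)))) / 2)"
proof -
  have "inversions K (w \<circ> root_reflection g) - inversions K w
    = (\<Sum>b\<in>roots_above K. sgn (height (w b)) / 2 - sgn (height (w (root_reflection g b))) / 2)"
    by (simp add: inversions_def diff_divide_distrib flip: sum_subtractf)
  then show ?thesis
    using sum_roots_above_reflect[OF assms, of "\<lambda>b. sgn (height (w b)) / 2" K]
    by (simp add: diff_divide_distrib)
qed

lemma pairing_reflect: "g \<noteq> 0 \<Longrightarrow> coroot g \<bullet> root_reflection g b = - (coroot g \<bullet> b)"
  by (simp add: root_reflection_def inner_diff_right coroot_inner_self)

lemma pairing_sum_above:
  assumes "g \<in> \<Phi>"
  shows "coroot g \<bullet> sum_above K = (\<Sum>b\<in>leaving K g. coroot g \<bullet> b)"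
proof -
  have "2 * (coroot g \<bullet> sum_above K)
      = (\<Sum>b\<in>roots_above K. coroot g \<bullet> b - coroot g \<bullet> root_reflection g b)"
    by (simp add: sum_above_def inner_sum_right sum_distrib_left
        pairing_reflect[OF root_nonzero[OF assms]])
  also have "\<dots> = (\<Sum>b\<in>leaving K g. 2 * (coroot g \<bullet> b))"
    by (subst sum_roots_above_reflect[OF assms])
      (simp add: pairing_reflect[OF root_nonzero[OF assms]])
  finally show ?thesis by (simp flip: sum_distrib_left)
qed

lemma leaving_root: "b \<in> leaving K g \<Longrightarrow> b \<in> \<Phi>"
  by (simp add: leaving_def roots_above_def)

lemma pos_int_ge1: "(x::real) \<in> \<int> \<Longrightarrow> x > 0 \<Longrightarrow> x \<ge> 1"
  by (auto elim!: Ints_cases)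

lemma pairing_leaving:
  assumes g: "g \<in> roots_above K" and b: "b \<in> leaving K g"
  shows "coroot g \<bullet> b \<ge> 1"
proof -
  have "level K b > 0" "level K b - (coroot g \<bullet> b) * level K g \<le> 0" "level K g > 0"
    using assms by (auto simp: leaving_def roots_above_def level_reflect)
  then have "coroot g \<bullet> b > 0" by (smt (verit) mult_nonpos_nonneg)
  then show ?thesis
    using pairing_Ints[OF roots_above_root[OF g] leaving_root[OF b]] pos_int_ge1 by blast
qed

lemma self_leaving: "g \<in> roots_above K \<Longrightarrow> g \<in> leaving K g"
  by (auto simp: leaving_def roots_above_def root_reflection_self)

lemma pairing_leaving_sharp:
  assumes "g \<in> roots_above K" and "b \<in> leaving K g"
  shows "coroot g \<bullet> b \<ge> 1 + of_bool (b = g)"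
  using pairing_leaving[OF assms] coroot_inner_self[OF root_nonzero[OF roots_above_root[OF assms(1)]]]
  by auto

lemma pairing_sum_above_eq:
  assumes "g \<in> roots_above K"
  shows "coroot g \<bullet> sum_above K - 1 = (\<Sum>b\<in>leaving K g. coroot g \<bullet> b - of_bool (b = g))"
  using self_leaving[OF assms] pairing_sum_above[OF roots_above_root[OF assms]]
  by (simp add: sum_subtractf of_bool_def)

lemma sgn_half_diff_bounds: "\<bar>(sgn x - sgn y) / 2\<bar> \<le> (1::real)"
  by (auto simp: sgn_if)

lemma inversions_right_bound:
  assumes "g \<in> roots_above K"
  shows "\<bar>inversions K (w \<circ> root_reflection g) - inversions K w\<bar> \<le> coroot g \<bullet> sum_above K - 1"
proof -
  have "\<bar>inversions K (w \<circ> root_reflection g) - inversions K w\<bar> \<le> (\<Sum>b\<in>leaving K g. 1)"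
    unfolding inversions_right[OF roots_above_root[OF assms]]
    by (rule order.trans[OF sum_abs sum_mono]) (rule sgn_half_diff_bounds)
  also have "\<dots> \<le> coroot g \<bullet> sum_above K - 1"
    unfolding pairing_sum_above_eq[OF assms]
    by (rule sum_mono) (use pairing_leaving_sharp[OF assms] in force)
  finally show ?thesis .
qed

lemma pairing_sum_above_ge2:
  assumes "g \<in> roots_above K"
  shows "coroot g \<bullet> sum_above K \<ge> 2"
proof -
  have "coroot g \<bullet> g - of_bool (g = g) \<le> (\<Sum>b\<in>leaving K g. coroot g \<bullet> b - of_bool (b = g))"
    by (rule member_le_sum)
      (use self_leaving[OF assms] pairing_leaving_sharp[OF assms] in \<open>force+\<close>)
  then show ?thesis
    using pairing_sum_above_eq[OF assms]
      coroot_inner_self[OF root_nonzero[OF roots_above_root[OF assms]]] by simp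
qed

text \<open>
  When \<open>w g\<close> is positive, \<open>w b - w (root_reflection g b)\<close> is a positive multiple of it for every
  leaving root \<open>b\<close>; all summands in \<open>inversions_right\<close> are then nonnegative and the one of
  \<open>g\<close> is already 1.
\<close>

lemma inversions_right_up_iff:
  assumes g: "g \<in> roots_above K" and w: "w \<in> W I"
  shows "inversions K (w \<circ> root_reflection g) = inversions K w + 1 \<longleftrightarrow>
    height (w g) > 0 \<and> (\<forall>b\<in>leaving K g - {g}.
      sgn (height (w b)) = sgn (height (w (root_reflection g b))))"
proof -
  let ?r = "root_reflection g"
  let ?t = "\<lambda>b. (sgn (height (w b)) - sgn (height (w (?r b)))) / 2"
  have gr: "g \<in> \<Phi>" using g roots_above_root by blast
  have diff: "inversions K (w \<circ> ?r) - inversions K w = ?t g + (\<Sum>b\<in>leaving K g - {g}. ?t b)"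
    using inversions_right[OF gr, of K w] sum.remove[OF finite_leaving self_leaving[OF g], of ?t] by simp
  have hr: "height (w (?r b)) = height (w b) - (coroot g \<bullet> b) * height (w g)" for b
    by (simp add: root_reflection_def linear_diff[OF W_linear[OF w]]
        linear_scale[OF W_linear[OF w]] level_diff level_scale)
  have tg: "?t g = sgn (height (w g))"
    by (simp add: root_reflection_self W_minus[OF w] sgn_minus)
  show ?thesis
  proof (cases "height (w g) > 0")
    case True
    have nn: "?t b \<ge> 0" if "b \<in> leaving K g" for b
    proof -
      have "(coroot g \<bullet> b) * height (w g) \<ge> 0" using pairing_leaving[OF g that] True by simp
      then show ?thesis unfolding hr by (auto simp: sgn_if)
    qed
    have "(\<Sum>b\<in>leaving K g - {g}. ?t b) = 0 \<longleftrightarrow> (\<forall>b\<in>leaving K g - {g}. ?t b = 0)"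
      using nn by (intro sum_nonneg_eq_0_iff) auto
    then show ?thesis using True diff tg by auto
  next
    case False
    have np: "?t b \<le> 0" if "b \<in> leaving K g" for b
    proof -
      have "(coroot g \<bullet> b) * height (w g) \<le> 0"
        using pairing_leaving[OF g that] False by (simp add: mult_nonneg_nonpos)
      then show ?thesis unfolding hr by (auto simp: sgn_if)
    qed
    then have "inversions K (w \<circ> ?r) - inversions K w \<le> 0"
      unfolding inversions_right[OF gr] by (intro sum_nonpos)
    then show ?thesis using False by auto
  qed
qed

text \<open>
  A quantum edge attains the lower bound for length differences, so every summand is extremal.
\<close>

lemma inversions_right_down:
  assumes g: "g \<in> roots_above K" and w: "w \<in> W I"
    and down: "inversions K (w \<circ> root_reflection g) = inversions K w + 1 - coroot g \<bullet> sum_above K"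
    and b: "b \<in> leaving K g"
  shows "height (w b) < 0" and "height (w (root_reflection g b)) > 0"
    and "b \<noteq> g \<Longrightarrow> coroot g \<bullet> b = 1"
proof -
  let ?r = "root_reflection g"
  let ?t = "\<lambda>b. (sgn (height (w b)) - sgn (height (w (?r b)))) / 2"
  let ?m = "\<lambda>b. coroot g \<bullet> b - of_bool (b = g)"
  have gr: "g \<in> \<Phi>" using g roots_above_root by blast
  have m: "?m b \<ge> 1" if "b \<in> leaving K g" for b
    using pairing_leaving_sharp[OF g that] by auto
  have t: "?t b \<ge> - 1" for b by (auto simp: sgn_if)
  have "(\<Sum>b\<in>leaving K g. ?t b + ?m b) = 0"
    using inversions_right[OF gr, of K w] pairing_sum_above_eq[OF g] down
    by (simp add: sum.distrib)
  moreover have nn: "?t b + ?m b \<ge> 0" if "b \<in> leaving K g" for b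
    using m[OF that] t[of b] by linarith
  ultimately have "?t b + ?m b = 0"
    using sum_nonneg_eq_0_iff[OF finite_leaving, of K g "\<lambda>b. ?t b + ?m b"] b by blast
  with m[OF b] t[of b] have "?t b = - 1" "?m b = 1" by linarith+
  then show "height (w b) < 0" "height (w (?r b)) > 0" "b \<noteq> g \<Longrightarrow> coroot g \<bullet> b = 1"
    by (auto simp: sgn_if split: if_splits)
qed

lemma leaving_simple:
  assumes "i \<in> I"
  shows "leaving I (\<alpha> i) = {\<alpha> i}"
proof -
  have "\<alpha> i \<in> roots_above I" using assms simple_root by (simp add: roots_above_def level_simple)
  then have "\<alpha> i \<in> leaving I (\<alpha> i)" by (rule self_leaving)
  moreover have "b = \<alpha> i" if "b \<in> leaving I (\<alpha> i)" for b
    using that simple_reflection_positive[of b i] assms by (force simp: leaving_def roots_above_def)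
  ultimately show ?thesis by blast
qed

lemma inversions_simple_right:
  assumes "w \<in> W I" "i \<in> I"
  shows "inversions I (w \<circ> s i) = inversions I w + sgn (height (w (\<alpha> i)))"
  using inversions_right[OF simple_root[OF assms(2)], of I w] W_minus[OF assms(1)]
  by (simp add: leaving_simple[OF assms(2)] root_reflection_self sgn_minus)

section \<open>Cosets of the parabolic subgroup\<close>

context
  fixes J :: "'i set"
  assumes J: "J \<subseteq> I"
begin

lemma parabolic_W: "u \<in> W J \<Longrightarrow> u \<in> W I"
  using W_mono[OF J] by blast

lemma parabolic_permutes_roots_above:
  assumes "u \<in> W J"
  shows "bij_betw u (roots_above (I - J)) (roots_above (I - J))"
  using assms W_inv[OF assms] J
  by (intro bij_betwI[of _ _ _ "inv u"])
    (auto simp: roots_above_def level_parabolic W_root[OF parabolic_W])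

lemma inversions_coset:
  assumes "u \<in> W J"
  shows "inversions (I - J) (w \<circ> u) = inversions (I - J) w"
  unfolding inversions_def
  using sum.reindex_bij_betw[OF parabolic_permutes_roots_above[OF assms],
      of "\<lambda>b. (1 - sgn (height (w b))) / 2"] by simp

lemma parabolic_fixes_sum_above:
  assumes "u \<in> W J"
  shows "u (sum_above (I - J)) = sum_above (I - J)"
  unfolding sum_above_def linear_sum[OF W_linear[OF assms]]
  by (rule sum.reindex_bij_betw[OF parabolic_permutes_roots_above[OF assms]])

lemma self_in_left_coset: "w \<in> left_coset \<alpha> J w"
  unfolding left_coset_def by (rule image_eqI[of _ _ id]) simp_all

lemma left_coset_W: "w \<in> W I \<Longrightarrow> v \<in> left_coset \<alpha> J w \<Longrightarrow> v \<in> W I"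
  unfolding left_coset_def using W_comp parabolic_W by auto

lemma left_coset_trans:
  assumes "v \<in> left_coset \<alpha> J w" "u \<in> left_coset \<alpha> J v"
  shows "u \<in> left_coset \<alpha> J w"
proof -
  obtain a b where "a \<in> W J" "b \<in> W J" "v = w \<circ> a" "u = v \<circ> b"
    using assms by (auto simp: left_coset_def)
  then show ?thesis
    unfolding left_coset_def using W_comp by (intro image_eqI[of _ _ "a \<circ> b"]) (auto simp: comp_assoc)
qed

lemma min_coset_reps_W: "x \<in> min_coset_reps I \<alpha> J \<Longrightarrow> x \<in> W I"
  by (simp add: min_coset_reps_def)

lemma min_coset_rep_positive:
  assumes x: "x \<in> min_coset_reps I \<alpha> J" and b: "b \<in> \<Phi>" "height b > 0" "level (I - J) b = 0"
  shows "height (x b) > 0"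
proof (rule positive_on_parabolic[OF min_coset_reps_W[OF x] J _ b])
  fix j assume j: "j \<in> J"
  have xW: "x \<in> W I" using x by (rule min_coset_reps_W)
  have "x \<circ> s j \<in> left_coset \<alpha> J x" using W_simple[OF j] by (auto simp: left_coset_def)
  then have "weyl_length I \<alpha> x \<le> weyl_length I \<alpha> (x \<circ> s j)"
    using x by (auto simp: min_coset_reps_def)
  then have "inversions I x \<le> inversions I (x \<circ> s j)"
    using weyl_length_eq_inversions[OF xW] weyl_length_eq_inversions[of "x \<circ> s j"]
      W_comp[OF xW W_simple] j J by (metis of_nat_le_iff subsetD)
  then have "sgn (height (x (\<alpha> j))) \<ge> 0"
    using inversions_simple_right[OF xW, of j] j J by auto
  moreover have "height (x (\<alpha> j)) \<noteq> 0"
    using j J height_nonzero W_root[OF xW simple_root] by blast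
  ultimately show "height (x (\<alpha> j)) > 0" by (auto simp: sgn_if split: if_splits)
qed

lemma length_min_coset_rep:
  assumes x: "x \<in> min_coset_reps I \<alpha> J"
  shows "real (weyl_length I \<alpha> x) = inversions (I - J) x"
proof -
  have "inversions I x = inversions (I - J) x"
    unfolding inversions_def
  proof (rule sum.mono_neutral_right)
    show "roots_above (I - J) \<subseteq> roots_above I"
      using roots_above_height by (auto simp: roots_above_def)
    show "\<forall>b\<in>roots_above I - roots_above (I - J). (1 - sgn (height (x b))) / 2 = 0"
    proof
      fix b assume b: "b \<in> roots_above I - roots_above (I - J)"
      then have "b \<in> \<Phi>" "height b > 0" by (auto simp: roots_above_def)
      moreover from this have "level (I - J) b = 0"
        using b level_nonneg[of b "I - J"] by (auto simp: roots_above_def)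
      ultimately show "(1 - sgn (height (x b))) / 2 = 0"
        using min_coset_rep_positive[OF x] by simp
    qed
  qed simp
  then show ?thesis using weyl_length_eq_inversions[OF min_coset_reps_W[OF x]] by simp
qed

lemma min_coset_rep_unique:
  assumes x: "x \<in> min_coset_reps I \<alpha> J" and u: "u \<in> W J" and xu: "x \<circ> u \<in> min_coset_reps I \<alpha> J"
  shows "u = id"
proof (rule positive_preserving_imp_id[OF parabolic_W[OF u]])
  fix b assume b: "b \<in> \<Phi>" "height b > 0"
  have ub: "u b \<in> \<Phi>" using W_root parabolic_W u b by blast
  have lu: "level (I - J) (u b) = level (I - J) b" using level_parabolic u J by blast
  show "height (u b) > 0"
  proof (rule ccontr)
    assume "\<not> height (u b) > 0"
    then have neg: "height (- u b) > 0" using height_cases[OF ub] by auto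
    then have "level (I - J) (- u b) \<ge> 0" using level_nonneg[of "- u b"] ub by simp
    moreover have "level (I - J) b \<ge> 0" using level_nonneg b by simp
    ultimately have z: "level (I - J) b = 0" using lu by simp
    have "height (x (- u b)) > 0" using min_coset_rep_positive[OF x _ neg] ub z lu by simp
    moreover have "height (x (u b)) > 0" using min_coset_rep_positive[OF xu b z] by simp
    ultimately show False using W_minus[OF min_coset_reps_W[OF x]] by simp
  qed
qed

lemma coset_floor:
  assumes w: "w \<in> W I"
  shows "coset_floor I \<alpha> J w \<in> min_coset_reps I \<alpha> J"
    and "\<exists>u\<in>W J. coset_floor I \<alpha> J w = w \<circ> u"
proof -
  obtain v where v: "v \<in> left_coset \<alpha> J w"
    "\<And>u. u \<in> left_coset \<alpha> J w \<Longrightarrow> weyl_length I \<alpha> v \<le> weyl_length I \<alpha> u"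
    using ex_has_least_nat[of "\<lambda>v. v \<in> left_coset \<alpha> J w" w "weyl_length I \<alpha>"]
      self_in_left_coset by blast
  have vm: "v \<in> min_coset_reps I \<alpha> J"
    unfolding min_coset_reps_def using v left_coset_W[OF w] left_coset_trans[OF v(1)] by blast
  have uniq: "x = v" if x: "x \<in> left_coset \<alpha> J w" "x \<in> min_coset_reps I \<alpha> J" for x
  proof -
    obtain a b where ab: "a \<in> W J" "b \<in> W J" "v = w \<circ> a" "x = w \<circ> b"
      using x v(1) by (auto simp: left_coset_def)
    have xe: "x = v \<circ> (inv a \<circ> b)" using ab by (simp add: comp_assoc W_comp_inv_left)
    moreover have "inv a \<circ> b \<in> W J" using ab W_comp W_inv by blast
    ultimately have "inv a \<circ> b = id" using min_coset_rep_unique[OF vm] x by metis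
    then show ?thesis using xe by simp
  qed
  have "coset_floor I \<alpha> J w = v"
    unfolding coset_floor_def
  proof (rule the_equality)
    show "v \<in> left_coset \<alpha> J w \<and> v \<in> min_coset_reps I \<alpha> J" using v(1) vm by blast
  qed (use uniq in blast)
  then show "coset_floor I \<alpha> J w \<in> min_coset_reps I \<alpha> J" "\<exists>u\<in>W J. coset_floor I \<alpha> J w = w \<circ> u"
    using vm v(1) unfolding left_coset_def by blast+
qed

lemma length_coset_floor:
  assumes "w \<in> W I"
  shows "real (weyl_length I \<alpha> (coset_floor I \<alpha> J w)) = inversions (I - J) w"
  using coset_floor[OF assms] length_min_coset_rep inversions_coset by metis

text \<open>
  For a minimal representative, a Bruhat edge can be recognised by lengths of cosets alone: the
  roots leaving at the two levels \<open>I\<close> and \<open>I - J\<close> differ only in ways that the criterion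
  \<open>inversions_right_up_iff\<close> does not notice.
\<close>

lemma bruhat_edge_iff:
  assumes x: "x \<in> min_coset_reps I \<alpha> J" and g: "g \<in> roots_above (I - J)"
  shows "bruhat_edge I \<alpha> x g \<longleftrightarrow>
    inversions (I - J) (x \<circ> root_reflection g) = inversions (I - J) x + 1"
proof -
  let ?r = "root_reflection g"
  have xW: "x \<in> W I" using x by (rule min_coset_reps_W)
  have gr: "g \<in> \<Phi>" "height g > 0" using g roots_above_root roots_above_height by auto
  have gI: "g \<in> roots_above I" using gr by (simp add: roots_above_def)
  have r: "?r b \<in> \<Phi>" if "b \<in> \<Phi>" for b using reflect_root gr that by blast
  have xm: "x (- b) = - x b" for b using W_minus xW by blast
  have "x \<circ> ?r \<in> W I" using W_comp[OF xW reflection_in_W[OF gr(1)]] .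
  then have "bruhat_edge I \<alpha> x g \<longleftrightarrow> inversions I (x \<circ> ?r) = inversions I x + 1"
    unfolding bruhat_edge_def
    by (metis weyl_length_eq_inversions[OF xW] weyl_length_eq_inversions of_nat_1 of_nat_add of_nat_eq_iff)
  also have "\<dots> \<longleftrightarrow> inversions (I - J) (x \<circ> ?r) = inversions (I - J) x + 1"
    unfolding inversions_right_up_iff[OF gI xW] inversions_right_up_iff[OF g xW]
  proof (intro conj_cong refl iffI ballI)
    assume gp: "height (x g) > 0"
    fix b assume eq: "\<forall>b\<in>leaving I g - {g}. sgn (height (x b)) = sgn (height (x (?r b)))"
      and b: "b \<in> leaving (I - J) g - {g}"
    have b': "b \<in> \<Phi>" "level (I - J) b > 0" "level (I - J) (?r b) \<le> 0" "height b > 0"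
      using b roots_above_height by (auto simp: leaving_def roots_above_def)
    show "sgn (height (x b)) = sgn (height (x (?r b)))"
    proof (cases "height (?r b) > 0")
      case False
      then have "b \<in> leaving I g" using b' by (auto simp: leaving_def roots_above_def)
      then show ?thesis using eq b by blast
    next
      case True
      then have "level (I - J) (?r b) = 0"
        using level_nonneg[OF r[OF b'(1)] True, of "I - J"] b'(3) by simp
      then have p: "height (x (?r b)) > 0" using min_coset_rep_positive[OF x] r b' True by blast
      have "height (x (?r b)) = height (x b) - (coroot g \<bullet> b) * height (x g)"
        by (simp add: root_reflection_def linear_diff[OF W_linear[OF xW]]
            linear_scale[OF W_linear[OF xW]] level_diff level_scale)
      moreover have "(coroot g \<bullet> b) * height (x g) > 0"
        using pairing_leaving[OF g, of b] b gp by simp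
      ultimately show ?thesis using p by simp
    qed
  next
    fix b assume eq: "\<forall>b\<in>leaving (I - J) g - {g}. sgn (height (x b)) = sgn (height (x (?r b)))"
      and b: "b \<in> leaving I g - {g}"
    have b': "b \<in> \<Phi>" "height b > 0" "height (?r b) < 0"
      using b height_nonzero r by (force simp: leaving_def roots_above_def)+
    have rl: "level (I - J) (?r b) \<le> 0"
      using level_nonneg[of "- ?r b" "I - J"] r b' by simp
    show "sgn (height (x b)) = sgn (height (x (?r b)))"
    proof (cases "level (I - J) b > 0")
      case True
      then have "b \<in> leaving (I - J) g" using b' rl by (auto simp: leaving_def roots_above_def)
      then show ?thesis using eq b by blast
    next
      case False
      \<comment> \<open>Here \<open>b\<close> belongs to the parabolic subsystem, and the roles are exchanged with
        \<open>- root_reflection g b\<close>, which does leave.\<close>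
      then have z: "level (I - J) b = 0"
        using level_nonneg[OF b'(1,2), of "I - J"] by simp
      let ?c = "- ?r b"
      have rc: "?r ?c = - b"
        using linear_neg[OF linear_root_reflection] root_reflection_involution by metis
      have m: "coroot g \<bullet> b > 0"
        using pairing_leaving[OF gI, of b] b by auto
      have "level (I - J) ?c = (coroot g \<bullet> b) * level (I - J) g"
        using z by (simp add: level_reflect)
      then have "level (I - J) ?c > 0" using m g by (simp add: roots_above_def)
      then have "?c \<in> leaving (I - J) g"
        using r b' z unfolding leaving_def roots_above_def by (simp add: rc)
      moreover have "?c \<noteq> g"
        using rc root_reflection_self[of g] b by force
      ultimately have "sgn (height (x ?c)) = sgn (height (x (?r ?c)))" using eq by blast
      then show ?thesis unfolding rc xm by (simp add: sgn_minus)
    qed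
  qed
  finally show ?thesis .
qed

lemma nonparabolic_roots_eq:
  "positive_roots \<Phi> I \<alpha> - parabolic_positive_roots \<Phi> I \<alpha> J = roots_above (I - J)"
proof -
  have "level (I - J) b \<noteq> 0 \<longleftrightarrow> level (I - J) b > 0" if "b \<in> \<Phi>" "height b > 0" for b
    using level_nonneg[OF that, of "I - J"] by auto
  then show ?thesis
    using level_pos_imp_height_pos[of _ "I - J"]
    unfolding positive_roots_eq parabolic_positive_roots_eq[OF J] roots_above_def by blast
qed

lemma rho_difference:
  "2 *\<^sub>R rho \<Phi> I \<alpha> - 2 *\<^sub>R parabolic_rho \<Phi> I \<alpha> J = sum_above (I - J)"
proof -
  have "parabolic_positive_roots \<Phi> I \<alpha> J \<subseteq> positive_roots \<Phi> I \<alpha>"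
    by (auto simp: parabolic_positive_roots_def)
  moreover have "finite (positive_roots \<Phi> I \<alpha>)"
    using finite_roots by (simp add: positive_roots_eq)
  ultimately show ?thesis
    by (simp add: rho_def parabolic_rho_def sum_above_def sum_diff flip: nonparabolic_roots_eq)
qed

lemma quantum_edge_iff:
  assumes x: "x \<in> min_coset_reps I \<alpha> J" and g: "g \<in> roots_above (I - J)"
  shows "quantum_edge \<Phi> I \<alpha> J x g \<longleftrightarrow> inversions (I - J) (x \<circ> root_reflection g)
    = inversions (I - J) x + 1 - coroot g \<bullet> sum_above (I - J)"
  unfolding quantum_edge_def rho_difference
  using length_coset_floor[OF W_comp[OF min_coset_reps_W[OF x] reflection_in_W]]
    length_min_coset_rep[OF x] roots_above_root[OF g] by simp

end

end

section \<open>The highest root and the affine simple roots\<close>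

locale irreducible_root_basis = root_basis +
  assumes irreducible: "irreducible_root_system \<Phi>"
begin

definition \<theta> :: 'a where
  "\<theta> = (SOME b. b \<in> \<Phi> \<and> (\<forall>c\<in>\<Phi>. height c \<le> height b))"

lemma theta_root: "\<theta> \<in> \<Phi>" and height_le_theta: "b \<in> \<Phi> \<Longrightarrow> height b \<le> height \<theta>"
proof -
  have "\<Phi> \<noteq> {}" using irreducible by (simp add: irreducible_root_system_def)
  then have "Max (height ` \<Phi>) \<in> height ` \<Phi>" "\<forall>c\<in>\<Phi>. height c \<le> Max (height ` \<Phi>)"
    using finite_roots by auto
  then have "\<exists>b. b \<in> \<Phi> \<and> (\<forall>c\<in>\<Phi>. height c \<le> height b)" by force
  then have "\<theta> \<in> \<Phi> \<and> (\<forall>c\<in>\<Phi>. height c \<le> height \<theta>)"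
    unfolding \<theta>_def by (rule someI_ex)
  then show "\<theta> \<in> \<Phi>" "b \<in> \<Phi> \<Longrightarrow> height b \<le> height \<theta>" by auto
qed

lemma height_ge_minus_theta: "b \<in> \<Phi> \<Longrightarrow> height b \<ge> - height \<theta>"
  using height_le_theta[of "- b"] by simp

lemma theta_height: "height \<theta> \<ge> 1"
  using height_cases[OF theta_root] height_ge_minus_theta[OF theta_root] by linarith

lemma coroot_pos_iff: "a \<noteq> 0 \<Longrightarrow> coroot a \<bullet> b > 0 \<longleftrightarrow> a \<bullet> b > 0"
  using inner_gt_zero_iff[of a]
  by (auto simp: coroot_def zero_less_divide_iff zero_less_mult_iff simp del: inner_gt_zero_iff)

lemma coroot_neg_iff: "a \<noteq> 0 \<Longrightarrow> coroot a \<bullet> b < 0 \<longleftrightarrow> a \<bullet> b < 0"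
  using coroot_pos_iff[of a "- b"] by simp

lemma theta_dominant:
  assumes b: "b \<in> \<Phi>" "height b > 0"
  shows "coroot \<theta> \<bullet> b \<ge> 0"
proof (rule ccontr)
  assume "\<not> coroot \<theta> \<bullet> b \<ge> 0"
  then have "coroot b \<bullet> \<theta> < 0"
    using coroot_neg_iff[OF root_nonzero[OF theta_root], of b]
      coroot_neg_iff[OF root_nonzero[OF b(1)], of \<theta>] by (simp add: inner_commute)
  then have "(coroot b \<bullet> \<theta>) * height b < 0" using b by (simp add: mult_neg_pos)
  then have "height (root_reflection b \<theta>) > height \<theta>" by (simp add: level_reflect)
  then show False using height_le_theta[OF reflect_root[OF b(1) theta_root]] by simp
qed

text \<open>
  If the pairing were at least 2, reflecting at \<open>\<theta>\<close> would produce a root below \<open>- \<theta>\<close> in height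
  unless \<open>b\<close> is as high as \<open>\<theta>\<close>; then the same argument with exchanged roles bounds the other
  pairing.
\<close>

lemma theta_pairing:
  assumes b: "b \<in> \<Phi>" "height b > 0" "b \<noteq> \<theta>"
  shows "coroot \<theta> \<bullet> b = 0 \<or> coroot \<theta> \<bullet> b = 1"
proof (rule ccontr)
  assume not01: "\<not> ?thesis"
  obtain k where k: "coroot \<theta> \<bullet> b = of_int k"
    using pairing_Ints[OF theta_root b(1)] by (auto elim: Ints_cases)
  obtain l where l: "coroot b \<bullet> \<theta> = of_int l"
    using pairing_Ints[OF b(1) theta_root] by (auto elim: Ints_cases)
  have k2: "k \<ge> 2" using k not01 theta_dominant[OF b(1,2)] by auto
  have nz: "\<theta> \<noteq> 0" "b \<noteq> 0" using root_nonzero theta_root b by auto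
  then have "\<theta> \<bullet> b > 0" using coroot_pos_iff[of \<theta> b] k k2 by simp
  then have l1: "l \<ge> 1" using coroot_pos_iff[of b \<theta>] nz l by (simp add: inner_commute)
  have "height b - of_int k * height \<theta> \<ge> - height \<theta>"
    using height_ge_minus_theta[OF reflect_root[OF theta_root b(1)]] by (simp add: level_reflect k)
  moreover have "of_int k * height \<theta> \<ge> 2 * height \<theta>" using k2 theta_height by simp
  ultimately have hb: "height b = height \<theta>" and kb: "of_int k * height \<theta> \<le> 2 * height \<theta>"
    using height_le_theta[OF b(1)] by linarith+
  have k': "k = 2" using kb theta_height k2 by simp
  have "height \<theta> - of_int l * height b \<ge> - height \<theta>"
    using height_ge_minus_theta[OF reflect_root[OF b(1) theta_root]] by (simp add: level_reflect l)
  then have "of_int l * height \<theta> \<le> 2 * height \<theta>" unfolding hb by linarith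
  then have "l \<le> 2" using theta_height by simp
  moreover have "l \<noteq> 1"
    using height_nonzero[OF reflect_root[OF b(1) theta_root]] by (auto simp: level_reflect l hb)
  ultimately have l': "l = 2" using l1 by linarith
  \<comment> \<open>Both pairings are 2, so the two roots have equal length and coincide.\<close>
  have "\<theta> \<bullet> b = \<theta> \<bullet> \<theta>" "b \<bullet> \<theta> = b \<bullet> b"
    using k l k' l' nz by (simp_all add: coroot_def divide_eq_eq)
  then have "(b - \<theta>) \<bullet> (b - \<theta>) = 0"
    by (simp add: inner_diff_left inner_diff_right inner_commute)
  then show False using b(3) by simp
qed

text \<open>
  The affine simple reflections act on finite Weyl group elements through the simple reflections and
  the reflection at \<open>\<theta>\<close>. The number \<open>\<epsilon>\<close> records whether the root is the gradient of the affine
  node, where multiplication is a quantum rather than a Bruhat step.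
\<close>

definition affine_simple :: "'a \<Rightarrow> real \<Rightarrow> bool" where
  "affine_simple a \<epsilon> \<longleftrightarrow> (\<exists>i\<in>I. a = \<alpha> i \<and> \<epsilon> = 0) \<or> (a = - \<theta> \<and> \<epsilon> = 1)"

lemma affine_simple_root: "affine_simple a \<epsilon> \<Longrightarrow> a \<in> \<Phi>"
  using simple_root theta_root by (auto simp: affine_simple_def)

lemma affine_simple_int: "affine_simple a \<epsilon> \<Longrightarrow> \<epsilon> = 0 \<or> \<epsilon> = 1"
  by (auto simp: affine_simple_def)

lemma theta_flip:
  assumes b: "b \<in> \<Phi>"
  shows "(sgn (height b) - sgn (height (root_reflection \<theta> b))) / 2
    = of_bool (b = - \<theta>) - of_bool (b = \<theta>) + coroot \<theta> \<bullet> b"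
proof -
  have nz: "\<theta> \<noteq> 0" using root_nonzero theta_root by blast
  have pos: "(sgn (height b) - sgn (height (root_reflection \<theta> b))) / 2
    = of_bool (b = - \<theta>) - of_bool (b = \<theta>) + coroot \<theta> \<bullet> b"
    if b: "b \<in> \<Phi>" "height b > 0" for b
  proof (cases "b = \<theta>")
    case True
    then show ?thesis
      using theta_height nz coroot_inner_self[OF nz]
      by (simp add: root_reflection_self eq_neg_iff_add_eq_0 flip: scaleR_2)
  next
    case False
    have nm: "b \<noteq> - \<theta>" using b theta_height by auto
    from theta_pairing[OF b False] show ?thesis
    proof
      assume "coroot \<theta> \<bullet> b = 0"
      then show ?thesis using False nm by (simp add: level_reflect)
    next
      assume k: "coroot \<theta> \<bullet> b = 1"
      then have "height (root_reflection \<theta> b) \<le> 0"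
        using height_le_theta[OF b(1)] by (simp add: level_reflect)
      then have "height (root_reflection \<theta> b) < 0"
        using height_nonzero[OF reflect_root[OF theta_root b(1)]] by simp
      then show ?thesis using False nm b k by simp
    qed
  qed
  show ?thesis
  proof (cases "height b > 0")
    case False
    then have "height (- b) > 0" using height_cases[OF b] by auto
    moreover have "root_reflection \<theta> (- b) = - root_reflection \<theta> b"
      using linear_neg[OF linear_root_reflection] by blast
    ultimately show ?thesis
      using pos[of "- b"] b by (simp add: sgn_minus minus_equation_iff[of b] eq_commute[of "- \<theta>"])
  qed (use pos b in blast)
qed

lemma inversions_affine_left:
  assumes "w \<in> W I" "affine_simple a \<epsilon>"
  shows "inversions K (root_reflection a \<circ> w) =
    inversions K w + sgn (level K (inv w a)) - \<epsilon> * (coroot (inv w a) \<bullet> sum_above K)"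
proof (rule inversions_left[OF assms(1) affine_simple_root[OF assms(2)]])
  fix b assume b: "b \<in> \<Phi>"
  from assms(2) show "(sgn (height b) - sgn (height (root_reflection a b))) / 2
    = of_bool (b = a) - of_bool (b = - a) - \<epsilon> * (coroot a \<bullet> b)"
    unfolding affine_simple_def
  proof (elim disjE bexE conjE)
    assume "a = - \<theta>" "\<epsilon> = 1"
    then show ?thesis using theta_flip[OF b] by (simp only: root_reflection_minus coroot_minus) simp
  qed (use simple_flip[OF _ b] in blast)
qed

text \<open>
  This is what indecomposability of the root system is needed for. A simple root outside the
  support of \<open>\<theta>\<close> would pair to 0 with \<open>\<theta>\<close> by dominance, hence be orthogonal to the whole
  support, and then the roots in the span of the support would split off.
\<close>

lemma theta_full_support:
  assumes k: "k \<in> I"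
  shows "level {k} \<theta> > 0"
proof (rule ccontr)
  obtain m where m: "\<theta> = (\<Sum>i\<in>I. real (m i) *\<^sub>R \<alpha> i)"
    using positive_coefficients[OF theta_root] theta_height by force
  define K where "K = {i \<in> I. m i > 0}"
  have mk: "level {i} \<theta> = m i" if "i \<in> I" for i using that by (simp add: m level_combination)
  assume "\<not> level {k} \<theta> > 0"
  then have kK: "k \<in> I - K" using k mk by (simp add: K_def)
  have "K \<noteq> {}"
  proof
    assume "K = {}"
    then have "\<theta> = 0" unfolding m by (intro sum.neutral) (auto simp: K_def)
    then show False using root_nonzero theta_root by blast
  qed
  have simple_le: "\<alpha> i \<bullet> \<alpha> j \<le> 0" if ij: "i \<in> I" "j \<in> I" "i \<noteq> j" for i j
  proof (rule ccontr)
    assume "\<not> \<alpha> i \<bullet> \<alpha> j \<le> 0"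
    then have "coroot (\<alpha> i) \<bullet> \<alpha> j > 0"
      using coroot_pos_iff[OF simple_nonzero[OF ij(1)]] by simp
    then have "level {i} (s i (\<alpha> j)) < 0" "level {j} (s i (\<alpha> j)) > 0"
      using ij by (simp_all add: level_reflect level_simple)
    moreover have "s i (\<alpha> j) \<in> \<Phi>" using reflect_root simple_root ij by blast
    ultimately show False
      using level_neg_imp_height_neg level_pos_imp_height_pos by fastforce
  qed
  have orth: "\<alpha> i \<bullet> \<alpha> j = 0" if i: "i \<in> K" and j: "j \<in> I - K" for i j
  proof -
    have jI: "j \<in> I" "m j = 0" using j by (auto simp: K_def)
    have t: "real (m l) * (\<alpha> l \<bullet> \<alpha> j) \<le> 0" if "l \<in> I" for l
      using simple_le[of l j] that jI by (cases "l = j") (auto simp: mult_nonneg_nonpos)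
    have "0 \<le> coroot \<theta> \<bullet> \<alpha> j"
      using theta_dominant[OF simple_root] jI by (simp add: level_simple)
    then have "0 \<le> \<theta> \<bullet> \<alpha> j"
      using coroot_neg_iff[of \<theta> "\<alpha> j"] root_nonzero[OF theta_root] by fastforce
    also have "\<theta> \<bullet> \<alpha> j = (\<Sum>l\<in>I. real (m l) * (\<alpha> l \<bullet> \<alpha> j))"
      by (simp add: m inner_sum_left)
    finally have "(\<Sum>l\<in>I. real (m l) * (\<alpha> l \<bullet> \<alpha> j)) = 0"
      using t by (intro antisym sum_nonpos) auto
    then have "\<forall>l\<in>I. real (m l) * (\<alpha> l \<bullet> \<alpha> j) = 0"
      using sum_nonneg_eq_0_iff[OF finite_I, of "\<lambda>l. - (real (m l) * (\<alpha> l \<bullet> \<alpha> j))"] t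
      by (simp add: sum_negf)
    then show ?thesis using i by (auto simp: K_def)
  qed
  define U V where "U = span (\<alpha> ` K)" and "V = span (\<alpha> ` (I - K))"
  have UV: "u \<bullet> v = 0" if "u \<in> U" "v \<in> V" for u v
  proof -
    have 1: "a \<bullet> v = 0" if "a \<in> \<alpha> ` K" for a
      using \<open>v \<in> V\<close> unfolding V_def
      by (induction rule: span_induct_alt) (use orth that in \<open>auto simp: inner_add_right\<close>)
    show ?thesis
      using \<open>u \<in> U\<close> unfolding U_def
      by (induction rule: span_induct_alt) (auto simp: inner_add_left 1)
  qed
  have stable: "s i v \<in> X" if "i \<in> I" "X = U \<or> X = V" "v \<in> X" for i v X
  proof (cases "\<alpha> i \<in> X")
    case True
    then show ?thesis using that unfolding root_reflection_def U_def V_def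
      by (auto intro: span_diff span_scale)
  next
    case False
    have "\<alpha> i \<in> U \<or> \<alpha> i \<in> V" using that(1) unfolding U_def V_def by (blast intro: span_base)
    then have "\<alpha> i \<bullet> v = 0" using UV[of "\<alpha> i" v] UV[of v "\<alpha> i"] that False by (auto simp: inner_commute)
    then show ?thesis using that(3) by (simp add: root_reflection_coroot_form)
  qed
  have W_stable: "w v \<in> X" if "w \<in> W I" "X = U \<or> X = V" "v \<in> X" for w v X
    using that by (induction rule: W_induct) (auto intro: stable)
  have split: "\<Phi> = (\<Phi> \<inter> U) \<union> (\<Phi> \<inter> V)"
  proof -
    have "b \<in> U \<or> b \<in> V" if "b \<in> \<Phi>" for b
    proof -
      obtain w i where w: "w \<in> W I" "i \<in> I" "b = w (\<alpha> i)" using root_conjugate_simple \<open>b \<in> \<Phi>\<close> by blast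
      have "\<alpha> i \<in> U \<or> \<alpha> i \<in> V" using w(2) unfolding U_def V_def by (blast intro: span_base)
      then show ?thesis using W_stable w by blast
    qed
    then show ?thesis by blast
  qed
  moreover have "\<alpha> i \<in> \<Phi> \<inter> U" if "i \<in> K" for i
    using that simple_root unfolding U_def K_def by (auto intro: span_base)
  moreover have "\<alpha> k \<in> \<Phi> \<inter> V"
    using kK simple_root unfolding V_def by (auto intro: span_base)
  ultimately show False
    using irreducible \<open>K \<noteq> {}\<close> UV unfolding irreducible_root_system_def
    by (metis (no_types, lifting) IntD2 empty_iff ex_in_conv)
qed

end

section \<open>Edges of the parabolic quantum Bruhat graph on arbitrary representatives\<close>

locale parabolic_root_basis = irreducible_root_basis \<Phi> I \<alpha>
  for \<Phi> :: "'a::euclidean_space set" and I :: "'i set" and \<alpha> :: "'i \<Rightarrow> 'a" +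
  fixes J :: "'i set"
  assumes J: "J \<subseteq> I"
begin

abbreviation "lev \<equiv> level (I - J)"
abbreviation "P \<equiv> roots_above (I - J)"
abbreviation "N \<equiv> inversions (I - J)"
abbreviation "S \<equiv> sum_above (I - J)"

text \<open>
  An edge is described by any element \<open>x\<close> of its source coset; \<open>\<delta>\<close> is 0 for Bruhat and 1 for quantum
  edges, so \<open>\<delta> *\<^sub>R coroot g\<close> is the weight.
\<close>

definition qb_edge :: "('a \<Rightarrow> 'a) \<Rightarrow> 'a \<Rightarrow> real \<Rightarrow> bool" where
  "qb_edge x g \<delta> \<longleftrightarrow> x \<in> W I \<and> g \<in> P \<and> (\<delta> = 0 \<or> \<delta> = 1) \<and>
     N (x \<circ> root_reflection g) = N x + 1 - \<delta> * (coroot g \<bullet> S)"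

lemma qb_edge_source: "qb_edge x g \<delta> \<Longrightarrow> x \<in> W I"
  and qb_edge_label: "qb_edge x g \<delta> \<Longrightarrow> g \<in> P"
  by (simp_all add: qb_edge_def)

lemma qb_edge_target: "qb_edge x g \<delta> \<Longrightarrow> x \<circ> root_reflection g \<in> W I"
  using W_comp reflection_in_W roots_above_root by (auto simp: qb_edge_def)

lemma qb_edge_type_unique: "qb_edge x g \<delta> \<Longrightarrow> qb_edge x g \<delta>' \<Longrightarrow> \<delta> = \<delta>'"
  using pairing_sum_above_ge2[of g "I - J"] by (auto simp: qb_edge_def)

lemma qb_edge_coset:
  assumes e: "qb_edge (x \<circ> u) g \<delta>" and x: "x \<in> W I" and u: "u \<in> W J"
  shows "qb_edge x (u g) \<delta>" and "x \<circ> u \<circ> root_reflection g = x \<circ> root_reflection (u g) \<circ> u"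
proof -
  show eq: "x \<circ> u \<circ> root_reflection g = x \<circ> root_reflection (u g) \<circ> u"
    using reflection_W[OF u, of g] by (simp add: comp_assoc)
  have "coroot (u g) \<bullet> S = coroot g \<bullet> S"
    using W_inner[OF u, of "coroot g" S] by (simp add: coroot_W[OF u] parabolic_fixes_sum_above[OF J u])
  moreover have "u g \<in> P"
    using parabolic_permutes_roots_above[OF J u] e by (auto simp: qb_edge_def bij_betw_def)
  ultimately show "qb_edge x (u g) \<delta>"
    using e x inversions_coset[OF J u, of x]
      inversions_coset[OF J u, of "x \<circ> root_reflection (u g)"] eq
    unfolding qb_edge_def by metis
qed

lemma height_W_reflect:
  "x \<in> W I \<Longrightarrow> height (x (root_reflection g b)) = height (x b) - (coroot g \<bullet> b) * height (x g)"
  by (simp add: root_reflection_def linear_diff[OF W_linear] linear_scale[OF W_linear]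
      level_diff level_scale)

lemma inv_comp_reflection:
  assumes "x \<in> W I" "g \<in> \<Phi>"
  shows "inv (x \<circ> root_reflection g) a = root_reflection g (inv x a)"
  using inv_comp_W[OF assms(1) reflection_in_W[OF assms(2)]] by simp

text \<open>
  Multiplying on the left by an affine simple reflection with \<open>lev (inv x a) > 0\<close> goes up along an
  edge; the sign of \<open>lev (inv x a)\<close> thus tells whether \<open>a\<close> is an ascent (positive), a descent
  (negative), or fixes the coset (zero).
\<close>

lemma qb_edge_up:
  assumes x: "x \<in> W I" and a: "affine_simple a \<epsilon>" and up: "lev (inv x a) > 0"
  shows "qb_edge x (inv x a) \<epsilon>" and "x \<circ> root_reflection (inv x a) = root_reflection a \<circ> x"
proof -
  show eq: "x \<circ> root_reflection (inv x a) = root_reflection a \<circ> x"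
    using reflection_inv_W[OF x] .
  have "inv x a \<in> P"
    using up W_root[OF W_inv[OF x] affine_simple_root[OF a]] by (simp add: roots_above_def)
  then show "qb_edge x (inv x a) \<epsilon>"
    using inversions_affine_left[OF x a, of "I - J"] affine_simple_int[OF a] x up
    unfolding qb_edge_def eq by simp
qed

text \<open>
  The diamond property, part one: an edge never turns an ascent into a non-ascent, nor a
  non-descent into a descent, unless it is the multiplication by that reflection itself.
  Otherwise \<open>inv x a\<close> or minus its reflection leaves \<open>P\<close>, and the sign conditions on leaving roots
  would make a simple root negative, or force the height of a root to lie strictly between
  \<open>- 1\<close> and 1 or beyond that of \<open>\<theta>\<close>.
\<close>

lemma qb_edge_sign_change:
  assumes e: "qb_edge x g \<delta>" and a: "affine_simple a \<epsilon>"
    and ch: "lev (inv x a) > 0 \<and> lev (root_reflection g (inv x a)) \<le> 0 \<or>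
      lev (inv x a) \<ge> 0 \<and> lev (root_reflection g (inv x a)) < 0"
  shows "inv x a = g"
proof (rule ccontr)
  let ?r = "root_reflection g"
  define c where "c = inv x a"
  assume "inv x a \<noteq> g"
  then have cg: "c \<noteq> g" by (simp add: c_def)
  have x: "x \<in> W I" and g: "g \<in> P" using e by (auto simp: qb_edge_def)
  have gr: "g \<in> \<Phi>" using g roots_above_root by blast
  have ar: "a \<in> \<Phi>" using a affine_simple_root by blast
  have cr: "c \<in> \<Phi>" unfolding c_def using W_root[OF W_inv[OF x] ar] .
  have xc: "x c = a" unfolding c_def using x by simp
  have xg: "x g \<in> \<Phi>" using W_root x gr by blast
  have g_leaving: "g \<in> leaving (I - J) g" using self_leaving g by blast
  have height_a: "height a = 1 \<or> height a = - height \<theta>"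
    using a by (auto simp: affine_simple_def level_simple)
  have bruhat: "height (x g) \<ge> 1 \<and> sgn (height (x b)) = sgn (height (x (?r b)))"
    if "\<delta> = 0" "b \<in> leaving (I - J) g" "b \<noteq> g" for b
    using inversions_right_up_iff[OF g x] that e height_pos_ge1[OF xg] by (auto simp: qb_edge_def)
  have quantum: "height (x g) < 0 \<and> height (x b) < 0 \<and> height (x (?r b)) > 0 \<and> coroot g \<bullet> b = 1"
    if "\<delta> = 1" "b \<in> leaving (I - J) g" "b \<noteq> g" for b
  proof -
    have d: "N (x \<circ> ?r) = N x + 1 - coroot g \<bullet> S" using e that by (auto simp: qb_edge_def)
    show ?thesis
      using inversions_right_down[OF g x d g_leaving] inversions_right_down[OF g x d that(2)] that(3)
      by auto
  qed
  have \<delta>: "\<delta> = 0 \<or> \<delta> = 1" using e by (auto simp: qb_edge_def)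
  show False
  proof (cases "lev c > 0")
    case True
    then have b: "c \<in> leaving (I - J) g"
      using ch cr by (auto simp: c_def leaving_def roots_above_def)
    have m: "coroot g \<bullet> c \<ge> 1" using pairing_leaving[OF g b] .
    have h: "height (x (?r c)) = height a - (coroot g \<bullet> c) * height (x g)"
      by (simp add: height_W_reflect[OF x] xc)
    have hr: "x (?r c) \<in> \<Phi>" using W_root[OF x reflect_root[OF gr cr]] .
    from \<delta> show False
    proof
      assume "\<delta> = 0"
      note B = bruhat[OF this b cg]
      then have p: "(coroot g \<bullet> c) * height (x g) \<ge> 1"
        using mult_mono[OF m, of 1 "height (x g)"] m by linarith
      from height_a show False
        using B h p height_ge_minus_theta[OF hr] theta_height by (auto simp: xc sgn_if split: if_splits)
    next
      assume "\<delta> = 1"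
      note Q = quantum[OF this b cg]
      then show False
        using height_a h height_ge_minus_theta[OF xg] by (auto simp: xc)
    qed
  next
    case False
    then have z: "lev c = 0" and n: "lev (?r c) < 0" using ch by (auto simp: c_def)
    define b where "b = - ?r c"
    have rb: "?r b = - c"
      using linear_neg[OF linear_root_reflection, of g "?r c"] by (simp add: b_def)
    have br: "b \<in> \<Phi>" using reflect_root gr cr by (simp add: b_def)
    have b: "b \<in> leaving (I - J) g"
      using br z n unfolding leaving_def roots_above_def by (simp add: rb) (simp add: b_def)
    have bg: "b \<noteq> g"
      using rb root_reflection_self[of g] cg by auto
    have m: "coroot g \<bullet> b \<ge> 1" using pairing_leaving[OF g b] .
    have xrb: "x (?r b) = - a" by (simp add: rb W_minus[OF x] xc)
    then have h: "height (x b) = - height a + (coroot g \<bullet> b) * height (x g)"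
      using height_W_reflect[OF x, of g b] by simp
    have xb: "x b \<in> \<Phi>" using W_root[OF x br] .
    from \<delta> show False
    proof
      assume "\<delta> = 0"
      note B = bruhat[OF this b bg]
      then have p: "(coroot g \<bullet> b) * height (x g) \<ge> 1"
        using mult_mono[OF m, of 1 "height (x g)"] m by linarith
      from height_a show False
        using B h p height_le_theta[OF xb] theta_height by (auto simp: xrb sgn_if split: if_splits)
    next
      assume "\<delta> = 1"
      note Q = quantum[OF this b bg]
      then show False
        using height_a h height_ge_minus_theta[OF xg] by (auto simp: xrb)
    qed
  qed
qed

text \<open>
  The diamond property, part two: if \<open>a\<close> has the same sign at both ends, the whole edge can be
  reflected. Its type may change, but the bound on length differences leaves no value other
  than 0 and 1 for the new type.
\<close>

lemma qb_edge_reflect: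
  assumes e: "qb_edge x g \<delta>" and a: "affine_simple a \<epsilon>"
    and same: "sgn (lev (inv x a)) = sgn (lev (root_reflection g (inv x a)))"
  shows "qb_edge (root_reflection a \<circ> x) g (\<delta> - \<epsilon> * (coroot (inv x a) \<bullet> g))"
proof -
  let ?r = "root_reflection g"
  define c where "c = inv x a"
  define \<delta>' where "\<delta>' = \<delta> - \<epsilon> * (coroot c \<bullet> g)"
  have x: "x \<in> W I" and g: "g \<in> P" using e by (auto simp: qb_edge_def)
  have gr: "g \<in> \<Phi>" using g roots_above_root by blast
  have ar: "a \<in> \<Phi>" using a affine_simple_root by blast
  have cr: "c \<in> \<Phi>" unfolding c_def using W_root[OF W_inv[OF x] ar] .
  have z: "x \<circ> ?r \<in> W I" using qb_edge_target[OF e] .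
  have "coroot (?r c) = coroot c - (coroot c \<bullet> g) *\<^sub>R coroot g"
    using coroot_orthogonal[OF orthogonal_map_root_reflection, of g c]
    by (simp add: root_reflection_coroot_form inner_commute)
  then have cS: "coroot (?r c) \<bullet> S = coroot c \<bullet> S - (coroot c \<bullet> g) * (coroot g \<bullet> S)"
    by (simp add: inner_diff_left)
  have "N ((root_reflection a \<circ> x) \<circ> ?r) = N (x \<circ> ?r) + sgn (lev (?r c)) - \<epsilon> * (coroot (?r c) \<bullet> S)"
    using inversions_affine_left[OF z a, of "I - J"] inv_comp_reflection[OF x gr, of a]
    by (simp add: comp_assoc c_def)
  moreover have "N (root_reflection a \<circ> x) = N x + sgn (lev c) - \<epsilon> * (coroot c \<bullet> S)"
    using inversions_affine_left[OF x a, of "I - J"] by (simp add: c_def)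
  moreover have "N (x \<circ> ?r) = N x + 1 - \<delta> * (coroot g \<bullet> S)" using e by (simp add: qb_edge_def)
  ultimately have eq: "N ((root_reflection a \<circ> x) \<circ> ?r)
      = N (root_reflection a \<circ> x) + 1 - \<delta>' * (coroot g \<bullet> S)"
    using same by (simp add: cS \<delta>'_def flip: c_def) (simp add: algebra_simps)
  have "\<delta>' \<in> \<int>"
    using pairing_Ints[OF cr gr] e affine_simple_int[OF a] by (auto simp: \<delta>'_def qb_edge_def)
  then obtain k where k: "\<delta>' = of_int k" by (auto elim: Ints_cases)
  define C where "C = coroot g \<bullet> S"
  have C: "C \<ge> 2" using pairing_sum_above_ge2[OF g] by (simp add: C_def)
  have "\<bar>1 - of_int k * C\<bar> \<le> C - 1"
    using inversions_right_bound[OF g, of "root_reflection a \<circ> x"] eq by (simp add: k C_def)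
  then have b: "of_int k * C \<le> C" "of_int k * C \<ge> 2 - C" by linarith+
  have "k \<le> 1" using b(1) C by simp
  moreover have "k > - 1"
  proof (rule ccontr)
    assume "\<not> k > - 1"
    then have "of_int k * C \<le> (- 1) * C" using C by (intro mult_right_mono) auto
    then show False using b(2) by linarith
  qed
  ultimately have "\<delta>' = 0 \<or> \<delta>' = 1" using k by auto
  moreover have "root_reflection a \<circ> x \<in> W I" using W_comp[OF reflection_in_W[OF ar] x] .
  ultimately show ?thesis using g eq by (simp add: qb_edge_def flip: c_def \<delta>'_def)
qed

end

section \<open>Weights modulo the parabolic coroot lattice\<close>

context parabolic_root_basis
begin

abbreviation "QJ \<equiv> coroot_lattice \<alpha> J"

lemma QJ_zero [simp]: "0 \<in> QJ"
  unfolding coroot_lattice_def by (auto intro!: exI[of _ "\<lambda>_. 0"])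

lemma QJ_add: "u \<in> QJ \<Longrightarrow> v \<in> QJ \<Longrightarrow> u + v \<in> QJ"
  unfolding coroot_lattice_def
proof (elim CollectE exE conjE)
  fix c d :: "'i \<Rightarrow> int"
  assume "u = (\<Sum>i\<in>J. of_int (c i) *\<^sub>R coroot (\<alpha> i))" "v = (\<Sum>i\<in>J. of_int (d i) *\<^sub>R coroot (\<alpha> i))"
  then show "u + v \<in> {\<Sum>i\<in>J. of_int (c i) *\<^sub>R coroot (\<alpha> i) |c. True}"
    by (intro CollectI exI[of _ "\<lambda>i. c i + d i"]) (simp add: scaleR_add_left sum.distrib)
qed

lemma QJ_minus: "v \<in> QJ \<Longrightarrow> - v \<in> QJ"
  unfolding coroot_lattice_def
proof (elim CollectE exE conjE)
  fix c :: "'i \<Rightarrow> int"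
  assume "v = (\<Sum>i\<in>J. of_int (c i) *\<^sub>R coroot (\<alpha> i))"
  then show "- v \<in> {\<Sum>i\<in>J. of_int (c i) *\<^sub>R coroot (\<alpha> i) |c. True}"
    by (intro CollectI exI[of _ "\<lambda>i. - c i"]) (simp add: sum_negf)
qed

lemma QJ_diff: "u \<in> QJ \<Longrightarrow> v \<in> QJ \<Longrightarrow> u - v \<in> QJ"
  using QJ_add[of u "- v"] QJ_minus[of v] by simp

lemma QJ_simple: "j \<in> J \<Longrightarrow> of_int k *\<^sub>R coroot (\<alpha> j) \<in> QJ"
proof -
  assume j: "j \<in> J"
  have fin: "finite J" using J finite_I finite_subset by blast
  have "(\<Sum>i\<in>J. of_int (if i = j then k else 0) *\<^sub>R coroot (\<alpha> i))
      = (\<Sum>i\<in>J. if i = j then of_int k *\<^sub>R coroot (\<alpha> j) else 0)"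
    by (intro sum.cong) auto
  also have "\<dots> = of_int k *\<^sub>R coroot (\<alpha> j)" using j fin by simp
  finally show ?thesis
    unfolding coroot_lattice_def by (intro CollectI exI[of _ "\<lambda>i. if i = j then k else 0"]) simp
qed

lemma coroot_moved_by_parabolic:
  assumes "u \<in> W J" "b \<in> \<Phi>"
  shows "coroot (u b) - coroot b \<in> QJ"
  using assms(1)
proof (induction rule: W_induct)
  case id
  show ?case by (metis QJ_zero cancel_comm_monoid_add_class.diff_cancel id_apply)
next
  case (simple j u)
  have ub: "u b \<in> \<Phi>" using W_root parabolic_W[OF J] simple assms by blast
  obtain k where k: "coroot (u b) \<bullet> \<alpha> j = of_int k"
    using pairing_Ints[OF ub simple_root] simple(1) J by (metis Ints_cases subsetD)
  have "coroot (s j (u b)) = coroot (u b) - of_int k *\<^sub>R coroot (\<alpha> j)"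
    using coroot_orthogonal[OF orthogonal_map_root_reflection, of "\<alpha> j" "u b"] k
    by (simp add: root_reflection_coroot_form inner_commute)
  then have "coroot (s j (u b)) - coroot b
      = (coroot (u b) - coroot b) - of_int k *\<^sub>R coroot (\<alpha> j)" by simp
  then show ?case
    unfolding comp_apply using QJ_diff[OF simple.IH QJ_simple[OF simple(1)]] by metis
qed

definition effective :: "'a set" where
  "effective = {d. \<exists>h\<in>positive_coroot_cone \<alpha> I. d - h \<in> QJ}"

lemma cone_add:
  "u \<in> positive_coroot_cone \<alpha> I \<Longrightarrow> v \<in> positive_coroot_cone \<alpha> I \<Longrightarrow> u + v \<in> positive_coroot_cone \<alpha> I"
  unfolding positive_coroot_cone_def
proof (elim CollectE exE conjE)
  fix c d :: "'i \<Rightarrow> nat"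
  assume "u = (\<Sum>i\<in>I. real (c i) *\<^sub>R coroot (\<alpha> i))" "v = (\<Sum>i\<in>I. real (d i) *\<^sub>R coroot (\<alpha> i))"
  then show "u + v \<in> {\<Sum>i\<in>I. real (c i) *\<^sub>R coroot (\<alpha> i) |c. True}"
    by (intro CollectI exI[of _ "\<lambda>i. c i + d i"]) (simp add: scaleR_add_left sum.distrib)
qed

lemma cone_zero: "0 \<in> positive_coroot_cone \<alpha> I"
  unfolding positive_coroot_cone_def by (auto intro!: exI[of _ "\<lambda>_. 0"])

lemma effective_QJ: "d \<in> QJ \<Longrightarrow> d \<in> effective"
  unfolding effective_def using cone_zero by force

lemma effective_add: "u \<in> effective \<Longrightarrow> v \<in> effective \<Longrightarrow> u + v \<in> effective"
proof -
  assume "u \<in> effective" "v \<in> effective"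
  then obtain g h where gh: "g \<in> positive_coroot_cone \<alpha> I" "h \<in> positive_coroot_cone \<alpha> I"
    "u - g \<in> QJ" "v - h \<in> QJ" unfolding effective_def by blast
  have "u + v - (g + h) = (u - g) + (v - h)" by simp
  then have "u + v - (g + h) \<in> QJ" using QJ_add[OF gh(3,4)] by metis
  then show ?thesis unfolding effective_def using cone_add[OF gh(1,2)] by blast
qed

lemma edge_weight_effective: "qb_edge x g \<delta> \<Longrightarrow> \<delta> *\<^sub>R coroot g \<in> effective"
proof -
  assume e: "qb_edge x g \<delta>"
  then have "\<delta> *\<^sub>R coroot g \<in> positive_coroot_cone \<alpha> I"
    using coroot_in_cone[of g] cone_zero roots_above_root roots_above_height
    by (auto simp: qb_edge_def)
  then show ?thesis unfolding effective_def by force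
qed

section \<open>Paths on cosets\<close>

text \<open>
  \<open>qb_path n d x y\<close>: some path with \<open>n\<close> edges leads from the coset of \<open>x\<close> to the coset of \<open>y\<close> and
  has weight \<open>d\<close> modulo the parabolic coroot lattice. Forgetting the vertices in between is
  harmless, because only the possible values of \<open>n\<close> and \<open>d\<close> matter; forgetting representatives
  makes left multiplication compatible with paths.
\<close>

inductive qb_path :: "nat \<Rightarrow> 'a \<Rightarrow> ('a \<Rightarrow> 'a) \<Rightarrow> ('a \<Rightarrow> 'a) \<Rightarrow> bool" where
  stay: "x \<in> W I \<Longrightarrow> u \<in> W J \<Longrightarrow> d \<in> QJ \<Longrightarrow> qb_path 0 d x (x \<circ> u)"
| step: "qb_edge x g \<delta> \<Longrightarrow> qb_path n e (x \<circ> root_reflection g) y \<Longrightarrow>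
    d - e - \<delta> *\<^sub>R coroot g \<in> QJ \<Longrightarrow> qb_path (Suc n) d x y"

lemma qb_path_W: "qb_path n d x y \<Longrightarrow> x \<in> W I \<and> y \<in> W I"
proof (induction rule: qb_path.induct)
  case (stay x u d)
  then show ?case using W_comp parabolic_W[OF J] by blast
next
  case (step x g \<delta> n e y d)
  then show ?case using qb_edge_source by blast
qed

lemma qb_path_weight_cong:
  assumes "qb_path n d x y" "d' - d \<in> QJ"
  shows "qb_path n d' x y"
  using assms(1)
proof cases
  case (stay u)
  then show ?thesis using assms(2) QJ_add[of "d' - d" d] qb_path.stay by force
next
  case (step g \<delta> n e)
  have eq: "d' - e - \<delta> *\<^sub>R coroot g = (d' - d) + (d - e - \<delta> *\<^sub>R coroot g)" by simp
  have "d' - e - \<delta> *\<^sub>R coroot g \<in> QJ" unfolding eq by (rule QJ_add[OF assms(2) step(4)])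
  then show ?thesis using qb_path.step[OF step(2,3)] step(1) by blast
qed

lemma qb_path_start_coset:
  assumes "qb_path n d x' y" "x' = x \<circ> u" "u \<in> W J" "x \<in> W I"
  shows "qb_path n d x y"
  using assms
proof (induction arbitrary: x rule: qb_path.induct)
  case (stay x' v d)
  have "x' \<circ> v = x \<circ> (u \<circ> v)" using stay by (simp only: comp_assoc)
  then show ?case using qb_path.stay[OF \<open>x \<in> W I\<close> W_comp[OF \<open>u \<in> W J\<close> \<open>v \<in> W J\<close>] \<open>d \<in> QJ\<close>] by metis
next
  case (step x' g \<delta> n e y d)
  have edge: "qb_edge x (u g) \<delta>"
    and eq: "x' \<circ> root_reflection g = x \<circ> root_reflection (u g) \<circ> u"
    using qb_edge_coset[of x u g \<delta>] step by metis+
  have path: "qb_path n e (x \<circ> root_reflection (u g)) y"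
    using step.IH[OF eq step.prems(2) qb_edge_target[OF edge]] .
  have g: "g \<in> \<Phi>" using qb_edge_label[OF step(1)] roots_above_root by blast
  have "\<delta> = 0 \<or> \<delta> = 1" using step(1) by (simp add: qb_edge_def)
  then have "\<delta> *\<^sub>R coroot (u g) - \<delta> *\<^sub>R coroot g \<in> QJ"
    using coroot_moved_by_parabolic[OF step.prems(2) g] by auto
  then have "(d - e - \<delta> *\<^sub>R coroot g) - (\<delta> *\<^sub>R coroot (u g) - \<delta> *\<^sub>R coroot g) \<in> QJ"
    by (rule QJ_diff[OF step(3)])
  then have "d - e - \<delta> *\<^sub>R coroot (u g) \<in> QJ" by simp
  then show ?case by (rule qb_path.step[OF edge path])
qed

lemma qb_path_start_coset':
  assumes "qb_path n d x y" "u \<in> W J"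
  shows "qb_path n d (x \<circ> u) y"
proof -
  have x: "x \<in> W I" using qb_path_W assms by blast
  have "x = (x \<circ> u) \<circ> inv u" using assms(2) by (simp add: comp_assoc)
  then show ?thesis
    using qb_path_start_coset[OF assms(1) _ W_inv[OF assms(2)]] W_comp[OF x parabolic_W[OF J assms(2)]]
    by blast
qed

lemma qb_path_snoc:
  assumes "qb_path n d x y" "qb_edge y g \<delta>"
  shows "qb_path (Suc n) (d + \<delta> *\<^sub>R coroot g) x (y \<circ> root_reflection g)"
  using assms
proof (induction rule: qb_path.induct)
  case (stay x u d)
  then have edge: "qb_edge x (u g) \<delta>"
    and eq: "x \<circ> u \<circ> root_reflection g = x \<circ> root_reflection (u g) \<circ> u"
    using qb_edge_coset by blast+
  have "qb_path 0 0 (x \<circ> root_reflection (u g)) (x \<circ> u \<circ> root_reflection g)"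
    unfolding eq using qb_path.stay[OF qb_edge_target[OF edge] \<open>u \<in> W J\<close> QJ_zero] .
  then have p: "qb_path (Suc 0) (\<delta> *\<^sub>R coroot (u g)) x (x \<circ> u \<circ> root_reflection g)"
    by (rule qb_path.step[OF edge]) simp
  have g: "g \<in> \<Phi>" using qb_edge_label[OF stay(4)] roots_above_root by blast
  have "\<delta> = 0 \<or> \<delta> = 1" using edge by (simp add: qb_edge_def)
  then have "\<delta> *\<^sub>R coroot (u g) - \<delta> *\<^sub>R coroot g \<in> QJ"
    using coroot_moved_by_parabolic[OF \<open>u \<in> W J\<close> g] by auto
  then have "d - (\<delta> *\<^sub>R coroot (u g) - \<delta> *\<^sub>R coroot g) \<in> QJ" by (rule QJ_diff[OF \<open>d \<in> QJ\<close>])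
  then show ?case by (intro qb_path_weight_cong[OF p]) (simp add: algebra_simps)
next
  case (step x h \<eta> n e y d)
  have "(d + \<delta> *\<^sub>R coroot g) - (e + \<delta> *\<^sub>R coroot g) - \<eta> *\<^sub>R coroot h = d - e - \<eta> *\<^sub>R coroot h" by simp
  then show ?case using qb_path.step[OF step(1) step.IH[OF step.prems]] step(3) by metis
qed

lemma qb_path_effective: "qb_path n d x y \<Longrightarrow> d \<in> effective"
proof (induction rule: qb_path.induct)
  case (stay x u d)
  show ?case using effective_QJ[OF stay(3)] .
next
  case (step x g \<delta> n e y d)
  have "d = (d - e - \<delta> *\<^sub>R coroot g) + (e + \<delta> *\<^sub>R coroot g)" by simp
  then show ?case
    using effective_add[OF effective_QJ[OF step(3)] effective_add[OF step.IH edge_weight_effective[OF step(1)]]]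
    by metis
qed

section \<open>Reflecting paths\<close>

context
  fixes a :: 'a and \<epsilon> :: real
  assumes a: "affine_simple a \<epsilon>"
begin

abbreviation (input) "ascent x \<equiv> lev (inv x a)"
abbreviation (input) "shift x \<equiv> \<epsilon> *\<^sub>R coroot (inv x a)"
abbreviation (input) "mirror x \<equiv> root_reflection a \<circ> x"

lemma mirror_W: "x \<in> W I \<Longrightarrow> mirror x \<in> W I"
  using W_comp reflection_in_W affine_simple_root[OF a] by blast

lemma inv_mirror: "x \<in> W I \<Longrightarrow> inv (mirror x) a = - inv x a"
  using inv_comp_W[OF reflection_in_W[OF affine_simple_root[OF a]], of x I] W_minus[OF W_inv]
  by (simp add: root_reflection_self)

lemma inv_coset: "x \<in> W I \<Longrightarrow> u \<in> W J \<Longrightarrow> inv (x \<circ> u) a = inv u (inv x a)"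
  using inv_comp_W by (metis comp_apply)

lemma ascent_coset: "x \<in> W I \<Longrightarrow> u \<in> W J \<Longrightarrow> ascent (x \<circ> u) = ascent x"
  unfolding inv_coset using level_parabolic[OF W_inv J] .

lemma shift_coset:
  assumes "x \<in> W I" "u \<in> W J"
  shows "shift (x \<circ> u) - shift x \<in> QJ"
  unfolding inv_coset[OF assms]
  using coroot_moved_by_parabolic[OF W_inv[OF assms(2)] W_root[OF W_inv[OF assms(1)] affine_simple_root[OF a]]]
    affine_simple_int[OF a] by auto

text \<open>
  The weight of the reflected edge differs from the old one by a coboundary, so along a path only
  the values of \<open>shift\<close> at the two ends survive.
\<close>

lemma weight_reflect:
  assumes "qb_edge x g \<delta>"
  shows "(\<delta> - \<epsilon> * (coroot (inv x a) \<bullet> g)) *\<^sub>R coroot g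
    = \<delta> *\<^sub>R coroot g - shift x + shift (x \<circ> root_reflection g)"
proof -
  have "inv (x \<circ> root_reflection g) a = root_reflection g (inv x a)"
    using inv_comp_reflection qb_edge_source[OF assms] roots_above_root[OF qb_edge_label[OF assms]] by blast
  moreover have "coroot (root_reflection g (inv x a))
      = coroot (inv x a) - (coroot (inv x a) \<bullet> g) *\<^sub>R coroot g"
    using coroot_orthogonal[OF orthogonal_map_root_reflection, of g "inv x a"]
    by (simp add: root_reflection_coroot_form inner_commute)
  ultimately have "coroot (inv (x \<circ> root_reflection g) a)
      = coroot (inv x a) - (coroot (inv x a) \<bullet> g) *\<^sub>R coroot g" by metis
  then show ?thesis
    by (simp only: scaleR_diff_right scaleR_diff_left scaleR_scaleR) (simp only: algebra_simps)
qed

lemma step_reflected: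
  assumes e: "qb_edge x g \<delta>" and d: "d - e - \<delta> *\<^sub>R coroot g \<in> QJ"
    and same: "sgn (ascent x) = sgn (ascent (x \<circ> root_reflection g))"
    and p: "qb_path n (e - shift (x \<circ> root_reflection g) + c) (mirror (x \<circ> root_reflection g)) y"
  shows "qb_path (Suc n) (d - shift x + c) (mirror x) y"
proof -
  have "inv (x \<circ> root_reflection g) a = root_reflection g (inv x a)"
    using inv_comp_reflection qb_edge_source[OF e] roots_above_root[OF qb_edge_label[OF e]] by blast
  then have edge: "qb_edge (mirror x) g (\<delta> - \<epsilon> * (coroot (inv x a) \<bullet> g))"
    using qb_edge_reflect[OF e a] same by metis
  have p': "qb_path n (e - shift (x \<circ> root_reflection g) + c) (mirror x \<circ> root_reflection g) y"
    using p by (simp only: comp_assoc)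
  show ?thesis
  proof (rule qb_path.step[OF edge p'])
    show "(d - shift x + c) - (e - shift (x \<circ> root_reflection g) + c)
      - (\<delta> - \<epsilon> * (coroot (inv x a) \<bullet> g)) *\<^sub>R coroot g \<in> QJ"
      unfolding weight_reflect[OF e] using d by (simp add: algebra_simps)
  qed
qed

text \<open>
  The weight agrees with that of \<open>qb_edge_up\<close> because source and label of an edge determine its type.
\<close>

lemma jump:
  assumes e: "qb_edge x g \<delta>"
    and ch: "ascent x > 0 \<and> ascent (x \<circ> root_reflection g) \<le> 0 \<or>
      ascent x \<ge> 0 \<and> ascent (x \<circ> root_reflection g) < 0"
  shows "ascent x > 0" and "x \<circ> root_reflection g = mirror x" and "\<delta> *\<^sub>R coroot g = shift x"
proof -
  have x: "x \<in> W I" using qb_edge_source[OF e] .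
  have "inv (x \<circ> root_reflection g) a = root_reflection g (inv x a)"
    using inv_comp_reflection x roots_above_root[OF qb_edge_label[OF e]] by blast
  then have g: "inv x a = g" using qb_edge_sign_change[OF e a] ch by metis
  then show up: "ascent x > 0" using qb_edge_label[OF e] by (simp add: roots_above_def)
  show "x \<circ> root_reflection g = mirror x" using qb_edge_up(2)[OF x a up] g by metis
  have "qb_edge x g \<epsilon>" using qb_edge_up(1)[OF x a up] g by metis
  then show "\<delta> *\<^sub>R coroot g = shift x" using qb_edge_type_unique[OF e] g by blast
qed

text \<open>
  A path from an ascent to a non-ascent contains the multiplication by the reflection; cutting that
  edge out and reflecting everything before it gives a path one step shorter.
\<close>

lemma strip_start:
  assumes "qb_path n d x y" "ascent x > 0" "ascent y \<le> 0"
  shows "\<exists>m. n = Suc m \<and> qb_path m (d - shift x) (mirror x) y"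
  using assms
proof (induction rule: qb_path.induct)
  case (stay x u d)
  then show ?case using ascent_coset[OF stay(1,2)] by linarith
next
  case (step x g \<delta> n e y d)
  let ?z = "x \<circ> root_reflection g"
  show ?case
  proof (cases "ascent ?z > 0")
    case True
    obtain m where m: "n = Suc m" "qb_path m (e - shift ?z) (mirror ?z) y"
      using step.IH[OF True step.prems(2)] by blast
    have "qb_path (Suc m) (d - shift x + 0) (mirror x) y"
      using True step.prems(1) m(2) by (intro step_reflected[OF step(1,3)]) simp_all
    then show ?thesis unfolding m(1) add_0_right by blast
  next
    case False
    then have z: "?z = mirror x" and w: "\<delta> *\<^sub>R coroot g = shift x"
      using jump[OF step(1)] step.prems(1) by (auto simp only: not_less)
    have "qb_path n e (mirror x) y" using step(2) unfolding z .
    moreover have "(d - shift x) - e \<in> QJ" using step(3) unfolding w by (simp add: algebra_simps)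
    ultimately show ?thesis using qb_path_weight_cong by blast
  qed
qed

lemma prepend_up:
  assumes x: "x \<in> W I" and up: "ascent x > 0" and p: "qb_path n d (mirror x) y"
  shows "qb_path (Suc n) (d + shift x) x y"
proof (rule qb_path.step[OF qb_edge_up(1)[OF x a up]])
  show "qb_path n d (x \<circ> root_reflection (inv x a)) y"
    unfolding qb_edge_up(2)[OF x a up] by (rule p)
qed simp

lemma append_up:
  assumes up: "ascent y > 0" and p: "qb_path n d x y"
  shows "qb_path (Suc n) (d + shift y) x (mirror y)"
proof -
  have y: "y \<in> W I" using qb_path_W p by blast
  show ?thesis
    using qb_path_snoc[OF p qb_edge_up(1)[OF y a up]] unfolding qb_edge_up(2)[OF y a up] .
qed

lemma mirror_mirror: "mirror (mirror x) = x"
  by (rule root_reflection_comp_self_left)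

text \<open>
  Dually, a path ending in a descent can be cut at its end. Reflecting between two descents is proved
  in the same induction, because the path may leave the descents on its way and return.
\<close>

lemma strip_end_or_reflect:
  assumes "qb_path n d x y" "ascent y < 0"
  shows "(ascent x \<ge> 0 \<longrightarrow> (\<exists>m. n = Suc m \<and> qb_path m (d + shift y) x (mirror y))) \<and>
    (ascent x < 0 \<longrightarrow> qb_path n (d - shift x + shift y) (mirror x) (mirror y))"
  using assms
proof (induction rule: qb_path.induct)
  case (stay x u d)
  have "d + (shift (x \<circ> u) - shift x) \<in> QJ" using stay shift_coset QJ_add by blast
  then have "d - shift x + shift (x \<circ> u) \<in> QJ" by (simp add: algebra_simps)
  then have "qb_path 0 (d - shift x + shift (x \<circ> u)) (mirror x) (mirror x \<circ> u)"
    using qb_path.stay[OF mirror_W[OF stay(1)] stay(2)] by blast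
  then have "qb_path 0 (d - shift x + shift (x \<circ> u)) (mirror x) (mirror (x \<circ> u))"
    unfolding comp_assoc .
  moreover have "\<not> ascent x \<ge> 0" using stay ascent_coset[OF stay(1,2)] by linarith
  ultimately show ?case by blast
next
  case (step x g \<delta> n e y d)
  let ?z = "x \<circ> root_reflection g"
  have x: "x \<in> W I" using qb_edge_source step by blast
  have stepz: "qb_path (Suc m) (d + c) x y'" if "qb_path m (e + c) ?z y'" for m c y'
    by (rule qb_path.step[OF step(1) that]) (use step(3) in simp)
  note IH = step.IH[OF step.prems]
  consider "ascent x \<ge> 0" "ascent ?z \<ge> 0" | "ascent x \<ge> 0" "ascent ?z < 0"
    | "ascent x < 0" "ascent ?z < 0" | "ascent x < 0" "ascent ?z \<ge> 0" by linarith
  then show ?case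
  proof cases
    case 1
    then obtain m where "n = Suc m" "qb_path m (e + shift y) ?z (mirror y)" using IH by blast
    then have "qb_path n (d + shift y) x (mirror y)" using stepz by blast
    then show ?thesis using 1(1) not_less by blast
  next
    case 2
    note j = jump[OF step(1) disjI2[OF conjI[OF 2]]]
    have "qb_path n (e - shift ?z + shift y) (mirror ?z) (mirror y)" using 2 IH by blast
    then have p: "qb_path n (e - shift (mirror x) + shift y) x (mirror y)"
      unfolding j(2) mirror_mirror .
    have "d - e - shift x \<in> QJ" using step(3) unfolding j(3) .
    then have "(d + shift y) - (e - shift (mirror x) + shift y) \<in> QJ"
      unfolding inv_mirror[OF x] by (simp add: algebra_simps)
    then have "qb_path n (d + shift y) x (mirror y)" using qb_path_weight_cong[OF p] by blast
    then show ?thesis using 2(1) not_less by blast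
  next
    case 3
    then have "qb_path n (e - shift ?z + shift y) (mirror ?z) (mirror y)" using IH by blast
    then have "qb_path (Suc n) (d - shift x + shift y) (mirror x) (mirror y)"
      by (rule step_reflected[OF step(1,3), rotated]) (use 3 in simp)
    then show ?thesis using 3 by (meson not_less)
  next
    case 4
    then obtain m where m: "n = Suc m" "qb_path m (e + shift y) ?z (mirror y)" using IH by blast
    then have "qb_path n (d + shift y) x (mirror y)" using stepz by blast
    then have p: "qb_path n (d + shift y) (mirror (mirror x)) (mirror y)" unfolding mirror_mirror .
    have "ascent (mirror x) > 0" unfolding inv_mirror[OF x] using 4 by simp
    then have "qb_path (Suc n) (d + shift y + shift (mirror x)) (mirror x) (mirror y)"
      using prepend_up[OF mirror_W[OF x]] p by blast
    moreover have "d + shift y + shift (mirror x) = d - shift x + shift y"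
      unfolding inv_mirror[OF x] by simp
    ultimately show ?thesis using 4 by (metis not_less)
  qed
qed

lemma strip_end:
  "qb_path n d x y \<Longrightarrow> ascent x \<ge> 0 \<Longrightarrow> ascent y < 0 \<Longrightarrow>
    \<exists>m. n = Suc m \<and> qb_path m (d + shift y) x (mirror y)"
  using strip_end_or_reflect by blast

lemma reflect_descents:
  "qb_path n d x y \<Longrightarrow> ascent x < 0 \<Longrightarrow> ascent y < 0 \<Longrightarrow>
    qb_path n (d - shift x + shift y) (mirror x) (mirror y)"
  using strip_end_or_reflect by blast

lemma reflect_ascents:
  assumes p: "qb_path n d x y" and up: "ascent x > 0" "ascent y > 0"
  shows "qb_path n (d - shift x + shift y) (mirror x) (mirror y)"
proof -
  have y: "y \<in> W I" using qb_path_W p by blast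
  have "ascent (mirror y) \<le> 0" unfolding inv_mirror[OF y] using up by simp
  then have "qb_path n (d + shift y - shift x) (mirror x) (mirror y)"
    using strip_start[OF append_up[OF up(2) p] up(1)] by simp
  then show ?thesis by (simp add: algebra_simps)
qed

end

section \<open>Existence of a minimal path\<close>

definition has_minimal_path :: "('a \<Rightarrow> 'a) \<Rightarrow> ('a \<Rightarrow> 'a) \<Rightarrow> bool" where
  "has_minimal_path x y \<longleftrightarrow> (\<exists>n d. qb_path n d x y \<and>
     (\<forall>n' d'. qb_path n' d' x y \<longrightarrow> n \<le> n' \<and> d' - d \<in> effective \<and> (n' = n \<longrightarrow> d' - d \<in> QJ)))"

text \<open>
  Prescribing \<open>k\<close> and \<open>c\<close> independently of the path is essential: all paths must be shortened
  by the same number of edges and the same weight for their order to be preserved.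
\<close>

lemma has_minimal_path_transfer:
  assumes min: "has_minimal_path x' y'"
    and shrink: "\<And>n d. qb_path n d x y \<Longrightarrow> \<exists>m. n = m + k \<and> qb_path m (d - c) x' y'"
    and grow: "\<And>n d. qb_path n d x' y' \<Longrightarrow> qb_path (n + k) (d + c) x y"
  shows "has_minimal_path x y"
proof -
  obtain n d where nd: "qb_path n d x' y'"
    "\<And>n' d'. qb_path n' d' x' y' \<Longrightarrow> n \<le> n' \<and> d' - d \<in> effective \<and> (n' = n \<longrightarrow> d' - d \<in> QJ)"
    using min unfolding has_minimal_path_def by blast
  have "n + k \<le> n' \<and> d' - (d + c) \<in> effective \<and> (n' = n + k \<longrightarrow> d' - (d + c) \<in> QJ)"
    if p: "qb_path n' d' x y" for n' d'
  proof -
    obtain m where "n' = m + k" "qb_path m (d' - c) x' y'" using shrink[OF p] by blast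
    then show ?thesis using nd(2)[of m "d' - c"] by (simp add: algebra_simps)
  qed
  then show ?thesis unfolding has_minimal_path_def using grow[OF nd(1)] by blast
qed

lemma has_minimal_path_coset:
  assumes "x \<in> W I" "u \<in> W J"
  shows "has_minimal_path x (x \<circ> u)"
  unfolding has_minimal_path_def
proof (intro exI conjI allI impI)
  show "qb_path 0 0 x (x \<circ> u)" using qb_path.stay assms by simp
  fix n' d' assume p: "qb_path n' d' x (x \<circ> u)"
  then show "d' - 0 \<in> effective" using qb_path_effective by simp
  show "d' - 0 \<in> QJ" if "n' = 0" using p that by (auto elim: qb_path.cases)
qed simp

text \<open>
  The minimal representative of a nontrivial coset inverts some simple root, and that root is not
  neutral because the representative keeps the positive roots of the parabolic positive.
\<close>

lemma exists_descent:
  assumes y: "y \<in> W I" "y \<notin> W J"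
  shows "\<exists>i\<in>I. lev (inv y (\<alpha> i)) < 0"
proof -
  obtain u where u: "u \<in> W J" "coset_floor I \<alpha> J y = y \<circ> u" using coset_floor(2)[OF J y(1)] by blast
  define v where "v = y \<circ> u"
  have v: "v \<in> min_coset_reps I \<alpha> J" using coset_floor(1)[OF J y(1)] u v_def by metis
  then have vW: "v \<in> W I" by (rule min_coset_reps_W[OF J])
  have "v \<noteq> id"
  proof
    assume "v = id"
    then have "y = inv u" using u W_comp_inv[OF u(1)] unfolding v_def
      by (metis comp_assoc comp_id id_comp)
    then show False using W_inv[OF u(1)] y by simp
  qed
  have "\<exists>i\<in>I. height (inv v (\<alpha> i)) < 0"
  proof (rule ccontr)
    assume neg: "\<not> ?thesis"
    have "height (inv v (\<alpha> i)) > 0" if "i \<in> I" for i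
      using neg height_nonzero[OF W_root[OF W_inv[OF vW] simple_root[OF that]]] that by force
    moreover have "level (I - I) b = 0" if "b \<in> \<Phi>" "height b > 0" for b
    proof (rule positive_coefficients[OF that])
      fix c assume "b = (\<Sum>i\<in>I. real (c i) *\<^sub>R \<alpha> i)"
      then show ?thesis by (simp add: level_combination)
    qed
    ultimately have "inv v = id"
      using positive_preserving_imp_id[OF W_inv[OF vW]] positive_on_parabolic[OF W_inv[OF vW] order.refl]
      by blast
    then show False using \<open>v \<noteq> id\<close> W_comp_inv[OF vW] by simp
  qed
  then obtain i where i: "i \<in> I" "height (inv v (\<alpha> i)) < 0" by blast
  have r: "- inv v (\<alpha> i) \<in> \<Phi>" using W_root[OF W_inv[OF vW] simple_root[OF i(1)]] by simp
  have "lev (inv v (\<alpha> i)) \<noteq> 0"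
  proof
    assume "lev (inv v (\<alpha> i)) = 0"
    then have "height (v (- inv v (\<alpha> i))) > 0"
      using min_coset_rep_positive[OF J v r] i by simp
    then show False using W_minus[OF vW] vW i by (simp add: level_simple)
  qed
  moreover have "lev (inv v (\<alpha> i)) \<le> 0" using level_nonneg[OF r, of "I - J"] i by simp
  moreover have "inv v (\<alpha> i) = inv u (inv y (\<alpha> i))"
    unfolding v_def using inv_comp_W[OF y(1) u(1)] by (metis comp_apply)
  ultimately show ?thesis using i level_parabolic[OF W_inv[OF u(1)] J] by (metis less_eq_real_def)
qed

text \<open>
  From every coset the trivial one is reached by ascents alone, stated here as an induction
  principle. The relation \<open>\<Sum>i\<in>I. m i *\<^sub>R \<alpha> i - \<theta> = 0\<close> with positive coefficients makes
  \<open>m i * lev (inv x (\<alpha> i))\<close>, and the same at \<open>- \<theta>\<close> with coefficient 1, a positive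
  circulation on the graph of ascents: at each vertex the outflow equals the inflow. So no
  ascent can lead into a set of vertices that none leads out of, and such a set is closed
  under all simple reflections.
\<close>

lemma ascent_induct:
  assumes w: "w \<in> W I" and base: "Q id"
    and coset: "\<And>x u. x \<in> W I \<Longrightarrow> u \<in> W J \<Longrightarrow> Q x \<Longrightarrow> Q (x \<circ> u)"
    and up: "\<And>x a \<epsilon>. x \<in> W I \<Longrightarrow> affine_simple a \<epsilon> \<Longrightarrow> lev (inv x a) > 0 \<Longrightarrow>
      Q (root_reflection a \<circ> x) \<Longrightarrow> Q x"
  shows "Q w"
proof (rule ccontr)
  assume "\<not> Q w"
  define B where "B = {x \<in> W I. \<not> Q x}"
  have fin: "finite B" using finite_W by (simp add: B_def)
  have wB: "w \<in> B" using w \<open>\<not> Q w\<close> by (simp add: B_def)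
  have B_W: "x \<in> W I" if "x \<in> B" for x using that by (simp add: B_def)
  have B_coset: "x \<circ> u \<in> B" if "x \<in> B" "u \<in> W J" for x u
  proof -
    have xu: "x \<circ> u \<in> W I" using that W_comp parabolic_W[OF J] B_W by blast
    have "(x \<circ> u) \<circ> inv u = x" using that(2) by (simp add: comp_assoc)
    then have "\<not> Q (x \<circ> u)" using coset[OF xu W_inv[OF that(2)]] that(1) unfolding B_def by force
    then show ?thesis using xu by (simp add: B_def)
  qed
  define F where "F a = (\<Sum>x\<in>B. lev (inv x a))" for a
  define E where "E a = {x \<in> B. root_reflection a \<circ> x \<notin> B}" for a
  have boundary: "F a = (\<Sum>x\<in>E a. lev (inv x a))" and down: "\<And>x. x \<in> E a \<Longrightarrow> lev (inv x a) \<le> 0"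
    if a: "affine_simple a \<epsilon>" for a \<epsilon>
  proof -
    let ?D = "B - E a"
    have inv: "lev (inv (root_reflection a \<circ> x) a) = - lev (inv x a)" if "x \<in> B" for x
      unfolding inv_mirror[OF a B_W[OF that]] by simp
    have "(\<Sum>x\<in>?D. lev (inv x a)) = (\<Sum>x\<in>?D. - lev (inv x a))"
    proof (rule sum.reindex_bij_witness[of _ "\<lambda>x. root_reflection a \<circ> x" "\<lambda>x. root_reflection a \<circ> x"])
      fix x assume x: "x \<in> ?D"
      then show "root_reflection a \<circ> x \<in> ?D" unfolding E_def by simp
      then show "- lev (inv (root_reflection a \<circ> x) a) = lev (inv x a)" using inv x by simp
    qed (auto simp: E_def)
    then have "(\<Sum>x\<in>?D. lev (inv x a)) = 0" by (simp add: sum_negf)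
    moreover have "E a \<subseteq> B" by (auto simp: E_def)
    ultimately show "F a = (\<Sum>x\<in>E a. lev (inv x a))"
      using sum.subset_diff[of "E a" B "\<lambda>x. lev (inv x a)"] fin by (simp add: F_def)
    fix x assume x: "x \<in> E a"
    then have "x \<in> W I" "\<not> Q x" "root_reflection a \<circ> x \<notin> B" by (auto simp: E_def B_def)
    moreover from this have "Q (root_reflection a \<circ> x)"
      unfolding B_def using mirror_W[OF a] by blast
    ultimately show "lev (inv x a) \<le> 0" using up[OF _ a, of x] by (meson not_less)
  qed
  have nonpos: "F a \<le> 0" if "affine_simple a \<epsilon>" for a \<epsilon>
    unfolding boundary[OF that] using down[OF that] by (rule sum_nonpos)
  have F_zero: "F (\<alpha> i) = 0" if i: "i \<in> I" for i
  proof -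
    obtain m where m: "\<theta> = (\<Sum>i\<in>I. real (m i) *\<^sub>R \<alpha> i)"
      using positive_coefficients[OF theta_root] theta_height by force
    have simple: "F (\<alpha> i) \<le> 0" if "i \<in> I" for i
      using nonpos[of "\<alpha> i" 0] that by (auto simp: affine_simple_def)
    have "F (- \<theta>) = - (\<Sum>i\<in>I. real (m i) * F (\<alpha> i))"
    proof -
      have "lev (inv x (- \<theta>)) = - (\<Sum>i\<in>I. real (m i) * lev (inv x (\<alpha> i)))" if "x \<in> B" for x
      proof -
        have iW: "inv x \<in> W I" using W_inv B_W that by blast
        show ?thesis
          by (simp add: m W_minus[OF iW] linear_sum[OF W_linear[OF iW]] linear_scale[OF W_linear[OF iW]]
              linear_sum[OF linear_level] level_scale)
      qed
      then have "F (- \<theta>) = (\<Sum>x\<in>B. - (\<Sum>i\<in>I. real (m i) * lev (inv x (\<alpha> i))))"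
        unfolding F_def by (rule sum.cong[OF HOL.refl])
      also have "\<dots> = - (\<Sum>i\<in>I. real (m i) * F (\<alpha> i))"
        by (simp add: F_def sum_negf sum_distrib_left sum.swap[of _ B I])
      finally show ?thesis .
    qed
    moreover have "F (- \<theta>) \<le> 0" using nonpos[of "- \<theta>" 1] by (simp add: affine_simple_def)
    ultimately have "(\<Sum>i\<in>I. - (real (m i) * F (\<alpha> i))) \<le> 0" by (simp add: sum_negf)
    moreover have nn: "- (real (m i) * F (\<alpha> i)) \<ge> 0" if "i \<in> I" for i
      using simple[OF that] by (simp add: mult_nonneg_nonpos)
    ultimately have "(\<Sum>i\<in>I. - (real (m i) * F (\<alpha> i))) = 0"
      by (intro antisym sum_nonneg) auto
    then have "- (real (m i) * F (\<alpha> i)) = 0"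
      using sum_nonneg_eq_0_iff[OF finite_I, of "\<lambda>i. - (real (m i) * F (\<alpha> i))"] nn i by blast
    moreover have "level {i} \<theta> = m i" using i by (simp add: m level_combination)
    then have "m i > 0" using theta_full_support[OF i] by simp
    ultimately show ?thesis by simp
  qed
  have closed: "s i \<circ> x \<in> B" if i: "i \<in> I" and x: "x \<in> B" for i x
  proof (rule ccontr)
    have a: "affine_simple (\<alpha> i) 0" using i by (auto simp: affine_simple_def)
    assume "s i \<circ> x \<notin> B"
    then have xE: "x \<in> E (\<alpha> i)" using x by (simp add: E_def)
    have "finite (E (\<alpha> i))" using fin by (simp add: E_def)
    moreover have "(\<Sum>x\<in>E (\<alpha> i). - lev (inv x (\<alpha> i))) = 0"
      using boundary[OF a] F_zero[OF i] by (simp add: sum_negf)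
    ultimately have "lev (inv x (\<alpha> i)) = 0"
      using sum_nonneg_eq_0_iff[of "E (\<alpha> i)" "\<lambda>x. - lev (inv x (\<alpha> i))"] down[OF a] xE by auto
    then have "root_reflection (inv x (\<alpha> i)) \<in> W J"
      using reflection_in_parabolic W_root[OF W_inv[OF B_W[OF x]] simple_root[OF i]] by blast
    then have "s i \<circ> x \<in> B"
      using B_coset[OF x] reflection_inv_W[OF B_W[OF x]] by metis
    then show False using \<open>s i \<circ> x \<notin> B\<close> by blast
  qed
  have "v \<circ> w \<in> B" if "v \<in> W I" for v
    using that
  proof (induction rule: W_induct)
    case id
    show ?case using wB by (metis id_comp)
  next
    case (simple i v)
    then show ?case using closed by (metis comp_assoc)
  qed
  then have "id \<in> B" using W_inv[OF w] W_inv_comp[OF w] by metis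
  then show False using base by (simp add: B_def)
qed

text \<open>
  The induction is on the number \<open>n\<close> of edges of some path. For fixed \<open>n\<close> the start is moved
  along ascents to the trivial coset. Either the end moves along, which changes all weights by
  the same amount, or the ascent separates the two ends and the path can be shortened; at the
  trivial coset the latter is always possible unless the path has already closed up.
\<close>

theorem has_minimal_path:
  "qb_path n d x y \<Longrightarrow> has_minimal_path x y"
proof (induction n arbitrary: d x y rule: less_induct)
  case (less n)
  have "\<forall>y d. qb_path n d x y \<longrightarrow> has_minimal_path x y" if "x \<in> W I" for x
    using that
  proof (rule ascent_induct, goal_cases base coset up)
    case base
    show ?case
    proof (intro allI impI)
      fix y d assume p: "qb_path n d id y"
      have y: "y \<in> W I" using qb_path_W p by blast
      show "has_minimal_path id y"
      proof (cases "y \<in> W J")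
        case True
        then show ?thesis using has_minimal_path_coset[OF W_id True] by (metis id_comp)
      next
        case False
        then obtain i where i: "i \<in> I" "lev (inv y (\<alpha> i)) < 0" using exists_descent y by blast
        have a: "affine_simple (\<alpha> i) 0" using i by (auto simp: affine_simple_def)
        have id0: "lev (inv id (\<alpha> i)) \<ge> 0" unfolding inv_id id_apply using i by (simp add: level_simple)
        note strip = strip_end[OF a _ id0 i(2)]
        have up: "lev (inv (s i \<circ> y) (\<alpha> i)) > 0" unfolding inv_mirror[OF a y] using i by simp
        have "has_minimal_path id (s i \<circ> y)" using strip[OF p] less.IH by blast
        then show ?thesis
        proof (rule has_minimal_path_transfer[where k = 1 and c = 0])
          fix n d assume "qb_path n d id y"
          then show "\<exists>m. n = m + 1 \<and> qb_path m (d - 0) id (s i \<circ> y)" using strip by fastforce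
        next
          fix n d assume "qb_path n d id (s i \<circ> y)"
          then show "qb_path (n + 1) (d + 0) id y"
            using append_up[OF a up] unfolding mirror_mirror[OF a] by fastforce
        qed
      qed
    qed
  next
    case (coset x u)
    show ?case
    proof (intro allI impI)
      fix y d assume p: "qb_path n d (x \<circ> u) y"
      then have "has_minimal_path x y"
        using coset qb_path_start_coset[OF p HOL.refl] by blast
      then show "has_minimal_path (x \<circ> u) y"
      proof (rule has_minimal_path_transfer[where k = 0 and c = 0])
        fix n d assume "qb_path n d (x \<circ> u) y"
        then show "\<exists>m. n = m + 0 \<and> qb_path m (d - 0) x y"
          using qb_path_start_coset[OF _ HOL.refl] coset by auto
      next
        fix n d assume "qb_path n d x y"
        then show "qb_path (n + 0) (d + 0) (x \<circ> u) y" using qb_path_start_coset' coset by simp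
      qed
    qed
  next
    case (up x a \<epsilon>)
    note a = up(2) and x = up(1)
    show ?case
    proof (intro allI impI)
      fix y d assume p: "qb_path n d x y"
      have y: "y \<in> W I" using qb_path_W p by blast
      let ?x' = "root_reflection a \<circ> x" and ?y' = "root_reflection a \<circ> y"
      show "has_minimal_path x y"
      proof (cases "lev (inv y a) > 0")
        case False
        then have d: "lev (inv y a) \<le> 0" by simp
        note strip = strip_start[OF a _ up(3) d]
        have "has_minimal_path ?x' y" using strip[OF p] less.IH by blast
        then show ?thesis
        proof (rule has_minimal_path_transfer[where k = 1 and c = "\<epsilon> *\<^sub>R coroot (inv x a)"])
          fix n d assume "qb_path n d x y"
          then show "\<exists>m. n = m + 1 \<and> qb_path m (d - \<epsilon> *\<^sub>R coroot (inv x a)) ?x' y"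
            using strip by fastforce
        next
          fix n d assume "qb_path n d ?x' y"
          then show "qb_path (n + 1) (d + \<epsilon> *\<^sub>R coroot (inv x a)) x y"
            using prepend_up[OF a x up(3)] by simp
        qed
      next
        case True
        note r = reflect_ascents[OF a _ up(3) True]
        have "has_minimal_path ?x' ?y'" using r[OF p] up(4) by blast
        then show ?thesis
        proof (rule has_minimal_path_transfer[where k = 0
              and c = "\<epsilon> *\<^sub>R coroot (inv x a) - \<epsilon> *\<^sub>R coroot (inv y a)"])
          fix n d assume "qb_path n d x y"
          then show "\<exists>m. n = m + 0 \<and>
              qb_path m (d - (\<epsilon> *\<^sub>R coroot (inv x a) - \<epsilon> *\<^sub>R coroot (inv y a))) ?x' ?y'"
            using r by (fastforce simp: algebra_simps)
        next
          fix n d assume q: "qb_path n d ?x' ?y'"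
          have "lev (inv ?x' a) < 0" "lev (inv ?y' a) < 0"
            unfolding inv_mirror[OF a x] inv_mirror[OF a y] using up(3) True by simp_all
          from reflect_descents[OF a q this]
          have "qb_path n (d - - (\<epsilon> *\<^sub>R coroot (inv x a)) + - (\<epsilon> *\<^sub>R coroot (inv y a))) x y"
            unfolding mirror_mirror[OF a] inv_mirror[OF a x] inv_mirror[OF a y] coroot_minus scaleR_minus_right .
          then show "qb_path (n + 0) (d + (\<epsilon> *\<^sub>R coroot (inv x a) - \<epsilon> *\<^sub>R coroot (inv y a))) x y"
            by (simp add: algebra_simps)
        qed
      qed
    qed
  qed
  moreover have "x \<in> W I" using qb_path_W less.prems by blast
  ultimately show ?case using less.prems by blast
qed

end

section \<open>Walks in the parabolic quantum Bruhat graph\<close>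

context parabolic_root_basis
begin

abbreviation "QB \<equiv> parabolic_QB \<Phi> I \<alpha> J"

lemma arc_iff: "(x, g) \<in> arcs QB \<longleftrightarrow> x \<in> min_coset_reps I \<alpha> J \<and> g \<in> P \<and>
    (bruhat_edge I \<alpha> x g \<or> quantum_edge \<Phi> I \<alpha> J x g)"
  by (auto simp: parabolic_QB_def nonparabolic_roots_eq[OF J])

lemma arc_qb_edge:
  assumes "(x, g) \<in> arcs QB"
  shows "qb_edge x g (of_bool (quantum_edge \<Phi> I \<alpha> J x g))"
  using assms min_coset_reps_W[OF J] bruhat_edge_iff[OF J] quantum_edge_iff[OF J]
  unfolding arc_iff qb_edge_def by (auto simp: of_bool_def)

lemma qb_edge_arc:
  assumes x: "x \<in> min_coset_reps I \<alpha> J" and e: "qb_edge x g \<delta>"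
  shows "(x, g) \<in> arcs QB" and "edge_weight \<Phi> I \<alpha> J (x, g) = \<delta> *\<^sub>R coroot g"
proof -
  have g: "g \<in> P" using qb_edge_label[OF e] .
  show arc: "(x, g) \<in> arcs QB"
    unfolding arc_iff using e x g bruhat_edge_iff[OF J x g] quantum_edge_iff[OF J x g]
    by (auto simp: qb_edge_def)
  show "edge_weight \<Phi> I \<alpha> J (x, g) = \<delta> *\<^sub>R coroot g"
    using qb_edge_type_unique[OF e arc_qb_edge[OF arc]] by (simp add: edge_weight_def)
qed

lemma awalk_iff: "pre_digraph.awalk QB x p y \<longleftrightarrow>
    x \<in> min_coset_reps I \<alpha> J \<and> set p \<subseteq> arcs QB \<and> pre_digraph.cas QB x p y"
  by (simp add: pre_digraph.awalk_def) (simp add: parabolic_QB_def)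

lemma cas_Nil: "pre_digraph.cas QB x [] y \<longleftrightarrow> x = y"
  by (simp add: pre_digraph.cas.simps)

lemma cas_Cons: "pre_digraph.cas QB x ((w, g) # p) y \<longleftrightarrow>
    w = x \<and> pre_digraph.cas QB (coset_floor I \<alpha> J (w \<circ> root_reflection g)) p y"
  by (simp only: pre_digraph.cas.simps) (simp add: parabolic_QB_def)

lemma walk_imp_qb_path:
  assumes "pre_digraph.awalk QB x p y"
  shows "qb_path (length p) (path_weight \<Phi> I \<alpha> J p) x y"
  using assms
proof (induction p arbitrary: x)
  case Nil
  then have "x = y" "x \<in> W I" using min_coset_reps_W[OF J] by (auto simp: awalk_iff cas_Nil)
  then show ?case using qb_path.stay[of x id 0] unfolding path_weight_def by (metis comp_id W_id QJ_zero
      list.map(1) list.size(3) sum_list.Nil)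
next
  case (Cons e p)
  obtain w g where e: "e = (w, g)" by (cases e)
  let ?v = "x \<circ> root_reflection g"
  let ?z = "coset_floor I \<alpha> J ?v"
  have w: "w = x" and arc: "(x, g) \<in> arcs QB" and p: "set p \<subseteq> arcs QB" "pre_digraph.cas QB ?z p y"
    using Cons.prems unfolding awalk_iff e cas_Cons by auto
  have edge: "qb_edge x g (of_bool (quantum_edge \<Phi> I \<alpha> J x g))" using arc_qb_edge[OF arc] .
  have v: "?v \<in> W I" using qb_edge_target[OF edge] .
  obtain u where u: "u \<in> W J" "?z = ?v \<circ> u" using coset_floor(2)[OF J v] by blast
  have "pre_digraph.awalk QB ?z p y"
    unfolding awalk_iff using coset_floor(1)[OF J v] p by blast
  then have "qb_path (length p) (path_weight \<Phi> I \<alpha> J p) ?z y" by (rule Cons.IH)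
  then have "qb_path (length p) (path_weight \<Phi> I \<alpha> J p) ?v y"
    using qb_path_start_coset u v by blast
  then have "qb_path (Suc (length p)) (path_weight \<Phi> I \<alpha> J (e # p)) x y"
    by (rule qb_path.step[OF edge]) (simp add: e w path_weight_def edge_weight_def)
  then show ?case unfolding list.size by simp
qed

lemma qb_path_imp_walk:
  assumes "qb_path n d x y" "x \<in> min_coset_reps I \<alpha> J" "y \<in> min_coset_reps I \<alpha> J"
  shows "\<exists>p. pre_digraph.awalk QB x p y \<and> length p = n \<and> path_weight \<Phi> I \<alpha> J p - d \<in> QJ"
  using assms
proof (induction n arbitrary: d x)
  case 0
  then obtain u where u: "u \<in> W J" "y = x \<circ> u" "d \<in> QJ" by (auto elim: qb_path.cases)
  then have "u = id" using min_coset_rep_unique[OF J 0(2)] 0(3) by blast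
  then have "y = x" using u(2) by (metis comp_id)
  then have "pre_digraph.awalk QB x [] y" using 0 by (simp add: awalk_iff cas_Nil)
  then show ?case using QJ_minus[OF u(3)] by (intro exI[of _ "[]"]) (simp add: path_weight_def)
next
  case (Suc n)
  obtain g \<delta> e where edge: "qb_edge x g \<delta>" and path: "qb_path n e (x \<circ> root_reflection g) y"
    and d: "d - e - \<delta> *\<^sub>R coroot g \<in> QJ"
    using Suc.prems(1) by (cases rule: qb_path.cases) blast+
  let ?v = "x \<circ> root_reflection g"
  let ?z = "coset_floor I \<alpha> J ?v"
  have v: "?v \<in> W I" using qb_edge_target[OF edge] .
  have z: "?z \<in> min_coset_reps I \<alpha> J" using coset_floor(1)[OF J v] .
  obtain u where u: "u \<in> W J" "?z = ?v \<circ> u" using coset_floor(2)[OF J v] by blast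
  have "qb_path n e ?z y" unfolding u(2) using qb_path_start_coset'[OF path u(1)] .
  then obtain p where p: "pre_digraph.awalk QB ?z p y" "length p = n"
    "path_weight \<Phi> I \<alpha> J p - e \<in> QJ"
    using Suc.IH z Suc.prems(3) by blast
  note arc = qb_edge_arc[OF Suc.prems(2) edge]
  have "pre_digraph.awalk QB x ((x, g) # p) y"
    using p(1) arc(1) Suc.prems(2) unfolding awalk_iff cas_Cons by simp
  moreover have "path_weight \<Phi> I \<alpha> J ((x, g) # p) - d
      = (path_weight \<Phi> I \<alpha> J p - e) - (d - e - \<delta> *\<^sub>R coroot g)"
    by (simp add: path_weight_def arc(2))
  then have "path_weight \<Phi> I \<alpha> J ((x, g) # p) - d \<in> QJ" using QJ_diff[OF p(3) d] by metis
  moreover have "length ((x, g) # p) = Suc n" using p(2) by simp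
  ultimately show ?case by blast
qed

theorem shortest_walk_weight_minimal:
  assumes x: "x \<in> min_coset_reps I \<alpha> J" and y: "y \<in> min_coset_reps I \<alpha> J"
    and p: "shortest_walk QB x p y" and q: "pre_digraph.awalk QB x q y"
  shows "path_weight \<Phi> I \<alpha> J q - path_weight \<Phi> I \<alpha> J p \<in> effective"
    and "shortest_walk QB x q y \<Longrightarrow> path_weight \<Phi> I \<alpha> J q - path_weight \<Phi> I \<alpha> J p \<in> QJ"
proof -
  let ?wt = "path_weight \<Phi> I \<alpha> J"
  have "has_minimal_path x y" using has_minimal_path walk_imp_qb_path q by blast
  then obtain n d where nd: "qb_path n d x y"
    and min: "\<And>n' d'. qb_path n' d' x y \<Longrightarrow>
      n \<le> n' \<and> d' - d \<in> effective \<and> (n' = n \<longrightarrow> d' - d \<in> QJ)"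
    unfolding has_minimal_path_def by blast
  obtain p0 where p0: "pre_digraph.awalk QB x p0 y" "length p0 = n"
    using qb_path_imp_walk[OF nd x y] by blast
  have shortest: "?wt r - d \<in> QJ" if r: "shortest_walk QB x r y" for r
  proof -
    have "pre_digraph.awalk QB x r y" "length r \<le> n"
      using r p0 by (auto simp: shortest_walk_def)
    then show ?thesis using min walk_imp_qb_path by force
  qed
  have "?wt q - d \<in> effective" using min walk_imp_qb_path q by blast
  moreover have "- (?wt p - d) \<in> effective" using effective_QJ QJ_minus shortest p by blast
  ultimately have "(?wt q - d) + - (?wt p - d) \<in> effective" by (rule effective_add)
  then show "?wt q - ?wt p \<in> effective" by simp
  show "?wt q - ?wt p \<in> QJ" if "shortest_walk QB x q y"
    using QJ_diff[OF shortest[OF that] shortest[OF p]] by simp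
qed

end

theorem proposition8p1:
  fixes \<Phi> :: "'a::euclidean_space set"
    and I J :: "'i set"
    and \<alpha> :: "'i \<Rightarrow> 'a"
    and x y :: "'a \<Rightarrow> 'a"
    and p q :: "(('a \<Rightarrow> 'a) \<times> 'a) list"
  assumes "irreducible_root_system \<Phi>"
    and "simple_roots \<Phi> I \<alpha>"
    and "J \<subseteq> I"
    and "x \<in> min_coset_reps I \<alpha> J"
    and "y \<in> min_coset_reps I \<alpha> J"
    and "shortest_walk (parabolic_QB \<Phi> I \<alpha> J) x p y"
    and "pre_digraph.awalk (parabolic_QB \<Phi> I \<alpha> J) x q y"
  shows "(\<exists>h \<in> positive_coroot_cone \<alpha> I.
            (path_weight \<Phi> I \<alpha> J q - path_weight \<Phi> I \<alpha> J p) - h \<in> coroot_lattice \<alpha> J) \<and>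
         (shortest_walk (parabolic_QB \<Phi> I \<alpha> J) x q y \<longrightarrow>
            path_weight \<Phi> I \<alpha> J q - path_weight \<Phi> I \<alpha> J p \<in> coroot_lattice \<alpha> J)"
proof -
  interpret parabolic_root_basis \<Phi> I \<alpha> J
    using assms(1-3) by unfold_locales (simp_all add: irreducible_root_system_def)
  show ?thesis
    using shortest_walk_weight_minimal[OF assms(4-7)] unfolding effective_def by blast
qed

end
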